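(* Let $N\ge2$. In each of the Hermite, Laguerre and trigonometric Jacobi cases described in the context, let $\tilde P_0,\dots,\tilde P_{N-1}$ be the corresponding orthonormal polynomials, $z_{1,N}<\dots<z_{N,N}$ the zeros of the $N$-th polynomial, $\pi$, $\kappa_N$, $\lambda_1,\dots,\lambda_N$ the corresponding data, and $\Sigma_N=(\sigma^N_{i,j})_{i,j=1,\dots,N}:=S_N^{-1}$ the corresponding covariance matrix. Then, for all $i,j=1,\dots,N$, $$\sigma^N_{i,j}=\frac{\sqrt{\pi(z_{i,N})\pi(z_{j,N})}}{\kappa_N\,\tilde P_{N-1}(z_{i,N})\tilde P_{N-1}(z_{j,N})}\sum_{k=0}^{N-1}\frac{\tilde P_k(z_{i,N})\tilde P_k(z_{j,N})}{\lambda_{N-k}} =\frac{(-1)^{i+j}}{\sqrt{\sum_{k,l=0}^{N-1}\tilde P_k^2(z_{i,N})\tilde P_l^2(z_{j,N})}}\sum_{k=0}^{N-1}\frac{\tilde P_k(z_{i,N})\tilde P_k(z_{j,N})}{\lambda_{N-k}}.$$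
   Context: The three cases are as follows; write $z_i=z_{i,N}$. Hermite case: $\tilde P_k=\tilde H_k=\frac{1}{2^{k/2}\sqrt{k!}}H_k$, the Hermite polynomials orthonormal with respect to the probability measure $\pi^{-1/2}e^{-x^2}dx$ (with $H_k$ the physicists' Hermite polynomials); $z_i$ are the zeros of $H_N$; $\pi(x)=1$, $\kappa_N=N$, $\lambda_k=k$; $S_N=(s_{i,j})$ with $s_{i,i}=1+\sum_{l\ne i}(z_i-z_l)^{-2}$ and $s_{i,j}=-(z_i-z_j)^{-2}$ for $i\ne j$. $\Sigma_N=S_N^{-1}$ is the covariance matrix of the limit, as $k\to\infty$, of $X_{t,k}/\sqrt t-\sqrt{2k}(z_1,\dots,z_N)$ for Bessel processes of type $A_{N-1}$. Laguerre case: let $\nu>0$, $\alpha=\nu-1$; $\tilde P_k=\tilde L_k^{(\alpha)}=\binom{k+\alpha}{k}^{-1/2}L_k^{(\alpha)}$, the Laguerre polynomials orthonormal with respect to the probability measure $\frac{1}{\Gamma(\alpha+1)}e^{-x}x^\alpha dx$ on $]0,\infty[$; $z_i$ are the zeros of $L_N^{(\alpha)}$ and $r_i=\sqrt{z_i}$; $\pi(x)=x$, $\kappa_N=N(N+\alpha)$, $\lambda_k=2k$ ($k=1,\dots,N$); $S_N=(s_{i,j})$ with $s_{i,i}=1+\frac{\nu}{r_i^2}+\sum_{l\ne i}(r_i+r_l)^{-2}+\sum_{l\ne i}(r_i-r_l)^{-2}$ and $s_{i,j}=(r_i+r_j)^{-2}-(r_i-r_j)^{-2}$ for $i\ne j$.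 $\Sigma_N=S_N^{-1}$ is the covariance matrix of the limit, as $\kappa\to\infty$, of $X_{t,(\kappa\nu,\kappa)}/\sqrt t-\sqrt{2\kappa}\,(r_1,\dots,r_N)$ for Bessel processes of type $B_N$. Trigonometric Jacobi case: let $a\ge0$, $b>0$, $\alpha=a+b-1$, $\beta=b-1$; $\tilde P_k=\tilde P_k^{(\alpha,\beta)}$ are the Jacobi polynomials normalized to be orthonormal (with positive leading coefficient) with respect to the probability measure proportional to $(1-x)^\alpha(1+x)^\beta dx$ on $]-1,1[$; $z_i$ are the zeros of $P_N^{(\alpha,\beta)}$; $\pi(x)=1-x^2$, $\kappa_N=\frac{4N(N+\alpha)(N+\beta)(N+\alpha+\beta)}{(2N+\alpha+\beta)^2(2N+\alpha+\beta-1)}$, $\lambda_k=2k(2N+\alpha+\beta+1-k)$; here $S_N$ is the matrix $\tilde S_N=(\tilde s_{i,j})$ with $\tilde s_{j,j}=4\sum_{l\ne j}\frac{1-z_j^2}{(z_j-z_l)^2}+2(a+b)\frac{1+z_j}{1-z_j}+2b\frac{1-z_j}{1+z_j}$ and $\tilde s_{i,j}=\frac{-4\sqrt{(1-z_j^2)(1-z_i^2)}}{(z_i-z_j)^2}$ for $i\ne j$, and $\Sigma_N$ is $\tilde\Sigma_N=\tilde S_N^{-1}$. *)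

theory Defs
  imports "HOL-Analysis.Analysis" "HOL-Computational_Algebra.Polynomial"
    "Jordan_Normal_Form.Matrix"
begin

text \<open>Physicists' Hermite polynomials; the recursion is what the Rodrigues formula
  \<open>H_k(x) = (-1)^k exp(x^2) (d/dx)^k exp(-x^2)\<close> gives on differentiating once more.\<close>

fun hermite_poly :: "nat \<Rightarrow> real poly" where
  "hermite_poly 0 = 1"
| "hermite_poly (Suc k) = [:0, 2:] * hermite_poly k - pderiv (hermite_poly k)"

definition laguerre_poly :: "real \<Rightarrow> nat \<Rightarrow> real poly" where
  "laguerre_poly \<alpha> k =
     (\<Sum>m\<le>k. Polynomial.monom ((-1) ^ m * ((real k + \<alpha>) gchoose (k - m)) / fact m) m)"

text \<open>The explicit formula
  \<open>P_k(x) = \<Sum>s\<le>k. binom(k+\<alpha>, k-s) binom(k+\<beta>, s) ((x-1)/2)^s ((x+1)/2)^(k-s)\<close>,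
  valid for all real \<open>\<alpha>\<close>, \<open>\<beta>\<close>.\<close>

definition jacobi_poly :: "real \<Rightarrow> real \<Rightarrow> nat \<Rightarrow> real poly" where
  "jacobi_poly \<alpha> \<beta> k =
     (\<Sum>s\<le>k. Polynomial.smult (((real k + \<alpha>) gchoose (k - s)) * ((real k + \<beta>) gchoose s))
               ([:-1/2, 1/2:] ^ s * [:1/2, 1/2:] ^ (k - s)))"

definition jacobi_weight :: "real \<Rightarrow> real \<Rightarrow> real \<Rightarrow> real" where
  "jacobi_weight \<alpha> \<beta> x = indicator {-1<..<1} x * (1 - x) powr \<alpha> * (1 + x) powr \<beta>"

definition jacobi_measure :: "real \<Rightarrow> real \<Rightarrow> real measure" where
  "jacobi_measure \<alpha> \<beta> =
     density lborel
       (\<lambda>x. ennreal (jacobi_weight \<alpha> \<beta> x / (LINT y|lborel. jacobi_weight \<alpha> \<beta> y)))"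

definition hermite_onp :: "nat \<Rightarrow> real poly" where
  "hermite_onp k = Polynomial.smult (1 / (2 powr (real k / 2) * sqrt (fact k))) (hermite_poly k)"

text \<open>This is the usual normalization: the leading coefficient has the sign \<open>(-1)^k\<close>.\<close>

definition laguerre_onp :: "real \<Rightarrow> nat \<Rightarrow> real poly" where
  "laguerre_onp \<alpha> k = Polynomial.smult (1 / sqrt ((real k + \<alpha>) gchoose k)) (laguerre_poly \<alpha> k)"

text \<open>For \<open>\<alpha>, \<beta> > -1\<close> the leading coefficient of \<open>jacobi_poly \<alpha> \<beta> k\<close> is
  \<open>2^(-k) binom(2k+\<alpha>+\<beta>, k) > 0\<close>, and distinct Jacobi polynomials are orthogonal, so dividing by
  the norm in L2 of the probability measure gives the orthonormal polynomials with positive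
  leading coefficient.\<close>

definition jacobi_onp :: "real \<Rightarrow> real \<Rightarrow> nat \<Rightarrow> real poly" where
  "jacobi_onp \<alpha> \<beta> k =
     Polynomial.smult (1 / sqrt (LINT x|jacobi_measure \<alpha> \<beta>. (poly (jacobi_poly \<alpha> \<beta> k) x)\<^sup>2))
       (jacobi_poly \<alpha> \<beta> k)"

text \<open>The cases carry their parameters: \<open>\<nu>\<close> for Laguerre (with \<open>\<alpha> = \<nu> - 1\<close>) and \<open>a\<close>, \<open>b\<close> for
  trigonometric Jacobi (with \<open>\<alpha> = a + b - 1\<close>, \<open>\<beta> = b - 1\<close>).\<close>

datatype ensemble = Hermite | Laguerre real | Jacobi real real

fun admissible :: "ensemble \<Rightarrow> bool" where
  "admissible Hermite \<longleftrightarrow> True"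
| "admissible (Laguerre \<nu>) \<longleftrightarrow> \<nu> > 0"
| "admissible (Jacobi a b) \<longleftrightarrow> a \<ge> 0 \<and> b > 0"

fun classical_poly :: "ensemble \<Rightarrow> nat \<Rightarrow> real poly" where
  "classical_poly Hermite k = hermite_poly k"
| "classical_poly (Laguerre \<nu>) k = laguerre_poly (\<nu> - 1) k"
| "classical_poly (Jacobi a b) k = jacobi_poly (a + b - 1) (b - 1) k"

fun onp :: "ensemble \<Rightarrow> nat \<Rightarrow> real poly" where
  "onp Hermite k = hermite_onp k"
| "onp (Laguerre \<nu>) k = laguerre_onp (\<nu> - 1) k"
| "onp (Jacobi a b) k = jacobi_onp (a + b - 1) (b - 1) k"

fun pi_fun :: "ensemble \<Rightarrow> real \<Rightarrow> real" where
  "pi_fun Hermite x = 1"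
| "pi_fun (Laguerre \<nu>) x = x"
| "pi_fun (Jacobi a b) x = 1 - x\<^sup>2"

fun kappa :: "ensemble \<Rightarrow> nat \<Rightarrow> real" where
  "kappa Hermite N = real N"
| "kappa (Laguerre \<nu>) N = (let \<alpha> = \<nu> - 1 in real N * (real N + \<alpha>))"
| "kappa (Jacobi a b) N =
     (let \<alpha> = a + b - 1; \<beta> = b - 1 in
       4 * real N * (real N + \<alpha>) * (real N + \<beta>) * (real N + \<alpha> + \<beta>) /
       ((2 * real N + \<alpha> + \<beta>)\<^sup>2 * (2 * real N + \<alpha> + \<beta> - 1)))"

fun lam :: "ensemble \<Rightarrow> nat \<Rightarrow> nat \<Rightarrow> real" where
  "lam Hermite N k = real k"
| "lam (Laguerre \<nu>) N k = 2 * real k"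
| "lam (Jacobi a b) N k =
     (let \<alpha> = a + b - 1; \<beta> = b - 1 in
       2 * real k * (2 * real N + \<alpha> + \<beta> + 1 - real k))"

text \<open>Indices run over \<open>0, \<dots>, N - 1\<close> throughout, so \<open>z i\<close> is the \<open>(i+1)\<close>-st zero.\<close>

definition ordered_zeros :: "real poly \<Rightarrow> nat \<Rightarrow> (nat \<Rightarrow> real) \<Rightarrow> bool" where
  "ordered_zeros p N z \<longleftrightarrow> strict_mono_on {..<N} z \<and> z ` {..<N} = {x. poly p x = 0}"

fun s_entry :: "ensemble \<Rightarrow> nat \<Rightarrow> (nat \<Rightarrow> real) \<Rightarrow> nat \<Rightarrow> nat \<Rightarrow> real" where
  "s_entry Hermite N z i j =
     (if i = j then 1 + (\<Sum>l\<in>{..<N} - {i}. 1 / (z i - z l)\<^sup>2)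
      else - 1 / (z i - z j)\<^sup>2)"
| "s_entry (Laguerre \<nu>) N z i j =
     (let r = (\<lambda>l. sqrt (z l)) in
      if i = j
      then 1 + \<nu> / (r i)\<^sup>2 + (\<Sum>l\<in>{..<N} - {i}. 1 / (r i + r l)\<^sup>2)
             + (\<Sum>l\<in>{..<N} - {i}. 1 / (r i - r l)\<^sup>2)
      else 1 / (r i + r j)\<^sup>2 - 1 / (r i - r j)\<^sup>2)"
| "s_entry (Jacobi a b) N z i j =
     (if i = j
      then 4 * (\<Sum>l\<in>{..<N} - {j}. (1 - (z j)\<^sup>2) / (z j - z l)\<^sup>2)
             + 2 * (a + b) * ((1 + z j) / (1 - z j)) + 2 * b * ((1 - z j) / (1 + z j))
      else - 4 * sqrt ((1 - (z j)\<^sup>2) * (1 - (z i)\<^sup>2)) / (z i - z j)\<^sup>2)"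

definition S_mat :: "ensemble \<Rightarrow> nat \<Rightarrow> (nat \<Rightarrow> real) \<Rightarrow> real mat" where
  "S_mat E N z = Matrix.mat N N (\<lambda>(i, j). s_entry E N z i j)"

text \<open>The inverse of \<open>S_mat E N z\<close>; meaningful only when that matrix is invertible.\<close>

definition Sigma_mat :: "ensemble \<Rightarrow> nat \<Rightarrow> (nat \<Rightarrow> real) \<Rightarrow> real mat" where
  "Sigma_mat E N z =
     (THE A. A \<in> carrier_mat N N \<and> inverts_mat (S_mat E N z) A \<and> inverts_mat A (S_mat E N z))"

end

theory Submission
  imports Defs "Jordan_Normal_Form.Determinant"
begin

text \<open>All three families satisfy \<open>A p'' + B p' + \<mu>\<^sub>k p = 0\<close>, where \<open>A\<close> is \<open>\<pi>\<close>. Expanding a polynomial \<open>q\<close> of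
  degree below \<open>N\<close> in the Lagrange basis \<open>P / (x - z\<^sub>j)\<close> of the zeros of \<open>P = p\<^sub>N\<close>, with coefficients
  \<open>u\<^sub>j = q(z\<^sub>j) / P'(z\<^sub>j)\<close>, and evaluating \<open>A q'' + B q'\<close> at the zeros turns the differential operator
  into the matrix \<open>T - \<mu>\<^sub>N\<close>, where the entries of \<open>T\<close> are rational in the zeros. Hence \<open>q = p\<^sub>k\<close> gives an
  eigenvector of \<open>T\<close> for \<open>\<mu>\<^sub>N - \<mu>\<^sub>k\<close>. Up to a factor \<open>1/2\<close> or \<open>2\<close>, the matrix \<open>S\<close> is the conjugate of \<open>T\<close>
  by \<open>diag (sqrt \<pi>(z\<^sub>i))\<close>. Because \<open>\<pi> P'\<close> is proportional to \<open>p\<^bsub>N-1\<^esub>\<close> at the zeros, the confluent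
  Christoffel--Darboux formula says that the conjugated eigenvectors are orthonormal, so \<open>S\<close> is
  inverted on its spectral decomposition. In the Jacobi case the three-term recurrence and the
  proportionality come from orthogonality with respect to the weight, and the proportionality
  constant is read off from the values of the polynomials at \<open>1\<close> and \<open>-1\<close>.\<close>

section \<open>The eigenvector equation at the zeros\<close>

text \<open>The obstacle is the diagonal of \<open>T\<close>: the operator applied to
  \<open>P / (x - z i)\<close> at its own node involves a third derivative of \<open>P\<close>.
  Factoring \<open>P = (x - z i) Q i\<close> and differentiating the equation of \<open>P\<close>
  once more supplies it; the sums of \<open>1 / (z i - z l)\<close> that appear are removed by the
  Stieltjes relations.

  No measure enters the common argument. Orthonormality is used as symmetry of the recurrence: the
  same \<open>a k\<close> multiplies \<open>p (k - 1)\<close> in \<open>x * p k\<close> and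
  \<open>p k\<close> in \<open>x * p (k - 1)\<close>. For Hermite and Laguerre the normalizing
  constants are explicit and this is algebra. The Jacobi norms stay unevaluated integrals; they
  cancel in \<open>\<kappa> = a N * c\<close>, where \<open>\<pi> P' = c p (N - 1)\<close> at the
  zeros.

  The second formula is a rewriting of the first: on the diagonal the kernel expresses
  \<open>p (N - 1)\<close> squared at a zero by the sum of all \<open>p k\<close> squared, and
  \<open>(-1)^(i + j)\<close> restores the sign lost in the square root, because \<open>P'\<close>
  alternates along the zeros.\<close>

lemma pderiv_linear_mult:
  fixes G :: "real poly"
  shows "pderiv ([:- c, 1:] * G) = G + [:- c, 1:] * pderiv G"
    and "pderiv (pderiv ([:- c, 1:] * G)) = 2 * pderiv G + [:- c, 1:] * pderiv (pderiv G)"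
proof -
  show *: "pderiv ([:- c, 1:] * G) = G + [:- c, 1:] * pderiv G" for G :: "real poly"
    unfolding pderiv_mult by (simp add: pderiv_pCons)
  show "pderiv (pderiv ([:- c, 1:] * G)) = 2 * pderiv G + [:- c, 1:] * pderiv (pderiv G)"
    unfolding * pderiv_add by simp
qed

lemma poly_prod_linear:
  fixes z :: "nat \<Rightarrow> real"
  shows "poly (\<Prod>l\<in>I. [:- z l, 1:]) x = (\<Prod>l\<in>I. x - z l)"
  by (simp add: poly_prod)

text \<open>Logarithmic derivatives: \<open>F'/F\<close> is \<open>\<sigma>\<^sub>1\<close>, whose
  derivative is \<open>- \<sigma>\<^sub>2\<close>, and
  \<open>F''/F = (F'/F)^2 + (F'/F)'\<close>.\<close>

lemma pderiv_prod_linear: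
  fixes z :: "nat \<Rightarrow> real"
  assumes "finite I" and "\<And>l. l \<in> I \<Longrightarrow> x \<noteq> z l"
  defines "F \<equiv> \<Prod>l\<in>I. [:- z l, 1:]"
    and "\<sigma>\<^sub>1 \<equiv> \<Sum>l\<in>I. 1 / (x - z l)" and "\<sigma>\<^sub>2 \<equiv> \<Sum>l\<in>I. 1 / (x - z l)\<^sup>2"
  shows "poly (pderiv F) x = \<sigma>\<^sub>1 * poly F x"
    and "poly (pderiv (pderiv F)) x = (\<sigma>\<^sub>1\<^sup>2 - \<sigma>\<^sub>2) * poly F x"
proof -
  have "poly (pderiv F) x = \<sigma>\<^sub>1 * poly F x \<and>
        poly (pderiv (pderiv F)) x = (\<sigma>\<^sub>1\<^sup>2 - \<sigma>\<^sub>2) * poly F x"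
    using assms(1,2) unfolding F_def \<sigma>\<^sub>1_def \<sigma>\<^sub>2_def
  proof (induction I)
    case empty
    then show ?case by simp
  next
    case (insert m J)
    define G where "G = (\<Prod>l\<in>J. [:- z l, 1:])"
    define s1 where "s1 = (\<Sum>l\<in>J. 1 / (x - z l))"
    define s2 where "s2 = (\<Sum>l\<in>J. 1 / (x - z l)\<^sup>2)"
    have IH: "poly (pderiv G) x = s1 * poly G x"
      "poly (pderiv (pderiv G)) x = (s1\<^sup>2 - s2) * poly G x"
      using insert unfolding G_def s1_def s2_def by auto
    have ne: "x - z m \<noteq> 0" using insert.prems by auto
    have p: "(\<Prod>l\<in>insert m J. [:- z l, 1:]) = [:- z m, 1:] * G"
      using insert by (simp add: G_def)
    have s: "(\<Sum>l\<in>insert m J. 1 / (x - z l)) = 1 / (x - z m) + s1"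
      "(\<Sum>l\<in>insert m J. 1 / (x - z l)\<^sup>2) = 1 / (x - z m)\<^sup>2 + s2"
      using insert by (simp_all add: s1_def s2_def)
    have "poly (pderiv ([:- z m, 1:] * G)) x = (x - z m) * (s1 * poly G x) + poly G x"
      unfolding pderiv_linear_mult by (simp add: IH algebra_simps)
    moreover have "poly (pderiv (pderiv ([:- z m, 1:] * G))) x
        = (x - z m) * ((s1\<^sup>2 - s2) * poly G x) + 2 * (s1 * poly G x)"
      unfolding pderiv_linear_mult(2) by (simp add: IH algebra_simps)
    moreover have "poly ([:- z m, 1:] * G) x = (x - z m) * poly G x"
      by (simp add: algebra_simps)
    moreover have "d * (s1 * g) + g = (1 / d + s1) * (d * g)"
      "d * ((s1\<^sup>2 - s2) * g) + 2 * (s1 * g) = ((1 / d + s1)\<^sup>2 - (1 / d\<^sup>2 + s2)) * (d * g)"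
      if "d \<noteq> 0" for d g
      using that by (simp_all add: field_simps power2_eq_square)
    ultimately show ?case unfolding p s using ne by simp
  qed
  then show "poly (pderiv F) x = \<sigma>\<^sub>1 * poly F x"
    and "poly (pderiv (pderiv F)) x = (\<sigma>\<^sub>1\<^sup>2 - \<sigma>\<^sub>2) * poly F x" by auto
qed

lemma sum_pderiv: "pderiv (\<Sum>i\<in>I. f i) = (\<Sum>i\<in>I. pderiv (f i))"
  using higher_pderiv_sum[of "Suc 0"] by simp

text \<open>An identity of polynomials rather than of values, so that it can be factored and
  differentiated.\<close>

definition ode :: "real poly \<Rightarrow> real poly \<Rightarrow> real \<Rightarrow> real poly \<Rightarrow> bool" where
  "ode A B \<mu> p \<longleftrightarrow> A * pderiv (pderiv p) + B * pderiv p + Polynomial.smult \<mu> p = 0"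

lemma ode_smult: "ode A B \<mu> p \<Longrightarrow> ode A B \<mu> (Polynomial.smult r p)"
  unfolding ode_def pderiv_smult
  by (metis (no_types, lifting) mult_smult_right smult_0_right smult_add_right smult_smult mult.commute)

locale simple_zeros_ode =
  fixes N :: nat and z :: "nat \<Rightarrow> real" and P A B :: "real poly" and C \<mu> :: real
  assumes inj: "inj_on z {..<N}"
    and P_eq: "P = Polynomial.smult C (\<Prod>l<N. [:- z l, 1:])"
    and C: "C \<noteq> 0"
    and odeP: "ode A B \<mu> P"
    and A_nz: "\<And>i. i < N \<Longrightarrow> poly A (z i) \<noteq> 0"
begin

definition Q :: "nat \<Rightarrow> real poly" where
  "Q j = Polynomial.smult C (\<Prod>l\<in>{..<N} - {j}. [:- z l, 1:])"

definition P' :: "nat \<Rightarrow> real" where "P' i = poly (pderiv P) (z i)"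

definition \<sigma>\<^sub>1 :: "nat \<Rightarrow> real" where "\<sigma>\<^sub>1 i = (\<Sum>l\<in>{..<N} - {i}. 1 / (z i - z l))"

definition \<sigma>\<^sub>2 :: "nat \<Rightarrow> real" where "\<sigma>\<^sub>2 i = (\<Sum>l\<in>{..<N} - {i}. 1 / (z i - z l)\<^sup>2)"

text \<open>The operator produces the diagonal entry
  \<open>2 A \<sigma>\<^sub>2 - 2 A' \<sigma>\<^sub>1 - B'\<close>; the Stieltjes relation trades
  the middle term for \<open>A' B / A\<close>. The eigenvalue \<open>\<mu>\<close> is kept out, so
  that the operator acts as \<open>T - \<mu>\<close>.\<close>

definition T :: "nat \<Rightarrow> nat \<Rightarrow> real" where
  "T i j = (if i = j
     then 2 * poly A (z i) * \<sigma>\<^sub>2 i + poly (pderiv A) (z i) * poly B (z i) / poly A (z i)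
            - poly (pderiv B) (z i)
     else - 2 * poly A (z i) / (z i - z j)\<^sup>2)"

lemma z_neq: "i < N \<Longrightarrow> j < N \<Longrightarrow> i \<noteq> j \<Longrightarrow> z i \<noteq> z j"
  using inj by (auto simp: inj_on_def)

lemma P_factor: "j < N \<Longrightarrow> P = [:- z j, 1:] * Q j"
  unfolding P_eq Q_def by (subst prod.remove[of _ j]) auto

lemma poly_Q_other: "i < N \<Longrightarrow> j < N \<Longrightarrow> i \<noteq> j \<Longrightarrow> poly (Q j) (z i) = 0"
  by (auto simp: Q_def poly_prod_linear)

lemma poly_Q_self: "j < N \<Longrightarrow> poly (Q j) (z j) = P' j"
  unfolding P'_def by (simp only: P_factor[of j] pderiv_linear_mult) simp

lemma P'_eq: "j < N \<Longrightarrow> P' j = C * (\<Prod>l\<in>{..<N} - {j}. z j - z l)"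
  by (subst poly_Q_self[symmetric]) (auto simp: Q_def poly_prod_linear)

lemma P'_nz: "j < N \<Longrightarrow> P' j \<noteq> 0"
  using C z_neq by (auto simp: P'_eq)

lemma degree_Q: "j < N \<Longrightarrow> degree (Q j) < N"
  using degree_prod_sum_le[of "{..<N} - {j}" "\<lambda>l. [:- z l, 1:]"]
  by (auto simp: Q_def C)

text \<open>Both sides have degree below \<open>N\<close> and agree at \<open>N\<close> distinct
  nodes; \<open>Q j\<close> is the Lagrange basis scaled to the value \<open>P' j\<close> at
  \<open>z j\<close>.\<close>

lemma interpolation:
  assumes "degree q < N"
  shows "q = (\<Sum>j<N. Polynomial.smult (poly q (z j) / P' j) (Q j))" (is "q = ?r")
proof (rule poly_eqI_degree)
  fix x assume "x \<in> z ` {..<N}"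
  then obtain i where i: "i < N" "x = z i" by auto
  have "poly ?r x = (\<Sum>j<N. poly q (z j) / P' j * poly (Q j) (z i))"
    by (simp add: poly_sum i)
  also have "\<dots> = (\<Sum>j<N. if j = i then poly q (z i) else 0)"
    using i by (intro sum.cong) (auto simp: poly_Q_other poly_Q_self P'_nz)
  finally show "poly q x = poly ?r x" using i by simp
next
  show "degree q < card (z ` {..<N})" using assms inj by (simp add: card_image)
  have "degree ?r \<le> N - 1"
    using degree_Q by (intro degree_sum_le) (auto intro!: order.trans[OF degree_smult_le] simp: Suc_leI less_Suc_eq_le[symmetric])
  then show "degree ?r < card (z ` {..<N})" using assms inj by (simp add: card_image)
qed

lemma pderiv_Q_self:
  assumes "i < N"
  shows "poly (pderiv (Q i)) (z i) = \<sigma>\<^sub>1 i * P' i"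
    and "poly (pderiv (pderiv (Q i))) (z i) = ((\<sigma>\<^sub>1 i)\<^sup>2 - \<sigma>\<^sub>2 i) * P' i"
proof -
  have ne: "\<And>l. l \<in> {..<N} - {i} \<Longrightarrow> z i \<noteq> z l" using z_neq assms by auto
  note * = pderiv_prod_linear[of "{..<N} - {i}" "z i" z, OF _ ne, folded \<sigma>\<^sub>1_def \<sigma>\<^sub>2_def]
  show "poly (pderiv (Q i)) (z i) = \<sigma>\<^sub>1 i * P' i"
    using * assms by (subst poly_Q_self[symmetric]) (simp_all add: Q_def pderiv_smult)
  show "poly (pderiv (pderiv (Q i))) (z i) = ((\<sigma>\<^sub>1 i)\<^sup>2 - \<sigma>\<^sub>2 i) * P' i"
    using * assms by (subst poly_Q_self[symmetric]) (simp_all add: Q_def pderiv_smult)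
qed

lemma pderiv_Q_other:
  assumes "i < N" "j < N" "i \<noteq> j"
  shows "poly (pderiv (Q j)) (z i) = P' i / (z i - z j)"
proof -
  have "P' i = poly (Q j) (z i) + (z i - z j) * poly (pderiv (Q j)) (z i)"
    unfolding P'_def by (simp only: P_factor[OF assms(2)] pderiv_linear_mult) (simp add: algebra_simps)
  then show ?thesis using poly_Q_other[OF assms] z_neq[OF assms] by (simp add: field_simps)
qed

text \<open>The equation of \<open>P = (x - z j) Q j\<close>, sorted by the Leibniz rule. Evaluating
  at \<open>z j\<close> isolates the first-order part, evaluating at another zero isolates the
  operator on \<open>Q j\<close>, and differentiating first reaches the second derivative of
  \<open>Q j\<close> at \<open>z j\<close>.\<close>

lemma ode_Q:
  assumes "j < N"
  shows "[:- z j, 1:] * (A * pderiv (pderiv (Q j)) + B * pderiv (Q j) + Polynomial.smult \<mu> (Q j))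
           + 2 * A * pderiv (Q j) + B * Q j = 0" (is "?l = 0")
proof -
  have "?l = A * pderiv (pderiv P) + B * pderiv P + Polynomial.smult \<mu> P"
    unfolding P_factor[OF assms] pderiv_linear_mult(2) unfolding pderiv_linear_mult(1)
    by (simp only: mult_smult_right[symmetric] distrib_left) (simp only: ac_simps mult_smult_right)
  then show ?thesis using odeP by (simp add: ode_def)
qed

text \<open>Electrostatic equilibrium of the zeros: at its own node \<open>ode_Q\<close> leaves
  \<open>2 A Q' + B Q = 0\<close>, and \<open>Q' / Q\<close> is \<open>\<sigma>\<^sub>1\<close>
  there.\<close>

lemma stieltjes:
  assumes "i < N"
  shows "2 * poly A (z i) * \<sigma>\<^sub>1 i = - poly B (z i)"
proof -
  have "poly ([:- z i, 1:] * (A * pderiv (pderiv (Q i)) + B * pderiv (Q i) + Polynomial.smult \<mu> (Q i))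
           + 2 * A * pderiv (Q i) + B * Q i) (z i) = 0"
    by (simp only: ode_Q[OF assms] poly_0)
  then have "2 * poly A (z i) * (\<sigma>\<^sub>1 i * P' i) + poly B (z i) * P' i = 0"
    by (simp add: pderiv_Q_self poly_Q_self assms)
  then have "P' i * (2 * poly A (z i) * \<sigma>\<^sub>1 i + poly B (z i)) = 0"
    by (simp add: algebra_simps)
  then show ?thesis using P'_nz[OF assms] by auto
qed

text \<open>\<open>Q j\<close> vanishes at \<open>z i\<close>, so the terms with
  \<open>\<mu>\<close> and \<open>B * Q j\<close> drop out and the operator equals
  \<open>- 2 A Q' / (z i - z j)\<close>.\<close>

lemma operator_Q_other:
  assumes "i < N" "j < N" "i \<noteq> j"
  shows "poly (A * pderiv (pderiv (Q j)) + B * pderiv (Q j)) (z i) = P' i * T i j"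
proof -
  have "poly ([:- z j, 1:] * (A * pderiv (pderiv (Q j)) + B * pderiv (Q j) + Polynomial.smult \<mu> (Q j))
           + 2 * A * pderiv (Q j) + B * Q j) (z i) = 0"
    by (simp only: ode_Q[OF assms(2)] poly_0)
  then have "(z i - z j) * poly (A * pderiv (pderiv (Q j)) + B * pderiv (Q j)) (z i)
      + 2 * poly A (z i) * (P' i / (z i - z j)) = 0"
    by (simp add: pderiv_Q_other poly_Q_other assms left_diff_distrib)
  moreover have "p = P' * (- 2 * a / d\<^sup>2)" if "d * p + 2 * a * (P' / d) = 0" "d \<noteq> 0"
    for p a d P' :: real
    using that by (simp add: field_simps power2_eq_square) algebra
  ultimately show ?thesis using z_neq[OF assms] assms(3) by (simp add: T_def)
qed

text \<open>At its own node \<open>ode_Q\<close> loses the operator to the factor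
  \<open>x - z i\<close>, so it is differentiated once. The result contains \<open>A Q''\<close>
  three times; with the Stieltjes relation it eliminates the square of
  \<open>\<sigma>\<^sub>1\<close>.\<close>

lemma operator_Q_self:
  assumes "i < N"
  shows "poly (A * pderiv (pderiv (Q i)) + B * pderiv (Q i)) (z i) = P' i * (T i i - \<mu>)"
proof -
  define a a' b b' s1 s2 p where defs: "a = poly A (z i)" "a' = poly (pderiv A) (z i)"
    "b = poly B (z i)" "b' = poly (pderiv B) (z i)" "s1 = \<sigma>\<^sub>1 i" "s2 = \<sigma>\<^sub>2 i" "p = P' i"
  have "poly (pderiv ([:- z i, 1:] * (A * pderiv (pderiv (Q i)) + B * pderiv (Q i) + Polynomial.smult \<mu> (Q i))
           + 2 * A * pderiv (Q i) + B * Q i)) (z i) = 0"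
    by (simp only: ode_Q[OF assms] pderiv_0 poly_0)
  then have "(a * ((s1\<^sup>2 - s2) * p) + b * (s1 * p) + \<mu> * p) + 2 * a' * (s1 * p)
      + 2 * a * ((s1\<^sup>2 - s2) * p) + b' * p + b * (s1 * p) = 0"
    unfolding pderiv_add pderiv_mult
    by (simp add: pderiv_mult pderiv_pCons pderiv_Q_self poly_Q_self assms defs algebra_simps)
  then have "p * (3 * a * (s1\<^sup>2 - s2) + 2 * (a' + b) * s1 + b' + \<mu>) = 0"
    by (simp add: algebra_simps)
  then have 1: "3 * a * (s1\<^sup>2 - s2) + 2 * (a' + b) * s1 + b' + \<mu> = 0"
    using P'_nz[OF assms] by (simp add: defs)
  have 2: "b = - 2 * a * s1" using stieltjes[OF assms] by (simp add: defs)
  have a: "a \<noteq> 0" using A_nz[OF assms] by (simp add: defs)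
  have "poly (A * pderiv (pderiv (Q i)) + B * pderiv (Q i)) (z i) = (a * (s1\<^sup>2 - s2) + b * s1) * p"
    by (simp add: pderiv_Q_self assms defs algebra_simps)
  moreover have "T i i = 2 * a * s2 + a' * b / a - b'" by (simp add: T_def defs)
  moreover have "a' * b / a = - 2 * a' * s1" using a by (simp add: 2)
  moreover have "a * (s1\<^sup>2 - s2) + b * s1 = 2 * a * s2 - 2 * a' * s1 - b' - \<mu>"
    using 1 unfolding 2 by (simp add: algebra_simps power2_eq_square)
  ultimately show ?thesis by (simp add: defs)
qed

text \<open>Row \<open>i\<close> of the operator carries the common factor \<open>P' i\<close>.
  Dividing by it leaves a matrix independent of \<open>q\<close> and \<open>\<mu>'\<close>, so all
  lower eigenpolynomials give eigenvectors of the same matrix.\<close>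

theorem T_eigenvector:
  assumes q: "degree q < N" "ode A B \<mu>' q" and "i < N"
  shows "(\<Sum>j<N. T i j * (poly q (z j) / P' j)) = (\<mu> - \<mu>') * (poly q (z i) / P' i)"
proof -
  define u where "u j = poly q (z j) / P' j" for j
  define M where "M r = A * pderiv (pderiv r) + B * pderiv r" for r
  have q_eq: "q = (\<Sum>j<N. Polynomial.smult (u j) (Q j))"
    unfolding u_def by (rule interpolation[OF q(1)])
  have "M q = (\<Sum>j<N. Polynomial.smult (u j) (M (Q j)))"
    unfolding M_def by (subst (1 2) q_eq)
      (simp add: sum_pderiv pderiv_smult sum_distrib_left sum.distrib smult_add_right)
  then have "poly (M q) (z i) = (\<Sum>j<N. u j * poly (M (Q j)) (z i))"
    by (simp add: poly_sum)
  also have "\<dots> = (\<Sum>j<N. P' i * (T i j * u j) - (if j = i then P' i * \<mu> * u i else 0))"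
    using \<open>i < N\<close> unfolding M_def
    by (intro sum.cong refl) (auto simp: operator_Q_self operator_Q_other simp del: poly_add poly_mult; simp add: algebra_simps)
  also have "\<dots> = P' i * ((\<Sum>j<N. T i j * u j) - \<mu> * u i)"
    using \<open>i < N\<close> by (simp add: sum_subtractf sum_distrib_left algebra_simps)
  finally have "P' i * ((\<Sum>j<N. T i j * u j) - \<mu> * u i) = poly (M q) (z i)" ..
  also have "M q = - Polynomial.smult \<mu>' q"
    using q(2) unfolding ode_def M_def by (simp add: eq_neg_iff_add_eq_0)
  also have "poly \<dots> (z i) = P' i * (- \<mu>' * u i)" using P'_nz[OF \<open>i < N\<close>] by (simp add: u_def)
  finally have "(\<Sum>j<N. T i j * u j) - \<mu> * u i = - \<mu>' * u i"
    using P'_nz[OF \<open>i < N\<close>] by (metis mult_left_cancel)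
  then show ?thesis unfolding u_def[symmetric] by (simp add: left_diff_distrib)
qed

end

section \<open>Christoffel--Darboux kernel\<close>

text \<open>The sums telescope because the same \<open>a k\<close> occurs going up and going down.
  The second identity is the limit of the first as \<open>y\<close> tends to \<open>x\<close>,
  obtained by running the induction with the differentiated recurrence. \<open>a 0 = 0\<close> makes
  the index \<open>0 - 1 = 0\<close> harmless.\<close>

lemma christoffel_darboux:
  fixes p :: "nat \<Rightarrow> real poly" and a b :: "nat \<Rightarrow> real"
  assumes "a 0 = 0"
    and rec: "\<And>k. k < n \<Longrightarrow> [:0, 1:] * p k
      = Polynomial.smult (a (Suc k)) (p (Suc k)) + Polynomial.smult (b k) (p k)
          + Polynomial.smult (a k) (p (k - 1))"
  shows "(x - y) * (\<Sum>k<n. poly (p k) x * poly (p k) y)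
           = a n * (poly (p n) x * poly (p (n - 1)) y - poly (p (n - 1)) x * poly (p n) y)"
    and "(\<Sum>k<n. (poly (p k) x)\<^sup>2)
           = a n * (poly (pderiv (p n)) x * poly (p (n - 1)) x
                      - poly (pderiv (p (n - 1))) x * poly (p n) x)"
proof -
  have val: "y * poly (p k) y = a (Suc k) * poly (p (Suc k)) y + b k * poly (p k) y + a k * poly (p (k - 1)) y"
    if "k < n" for k y
    using arg_cong[OF rec[OF that], of "\<lambda>q. poly q y"] by simp
  have der: "poly (p k) y + y * poly (pderiv (p k)) y
      = a (Suc k) * poly (pderiv (p (Suc k))) y + b k * poly (pderiv (p k)) y
          + a k * poly (pderiv (p (k - 1))) y" if "k < n" for k y
    using arg_cong[OF rec[OF that], of "\<lambda>q. poly (pderiv q) y"]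
    by (simp add: pderiv_mult pderiv_add pderiv_smult pderiv_pCons)
  have "(x - y) * (\<Sum>k<m. poly (p k) x * poly (p k) y)
           = a m * (poly (p m) x * poly (p (m - 1)) y - poly (p (m - 1)) x * poly (p m) y) \<and>
        (\<Sum>k<m. (poly (p k) x)\<^sup>2)
           = a m * (poly (pderiv (p m)) x * poly (p (m - 1)) x
                      - poly (pderiv (p (m - 1))) x * poly (p m) x)" if "m \<le> n" for m
    using that
  proof (induction m)
    case 0
    then show ?case by (simp add: \<open>a 0 = 0\<close>)
  next
    case (Suc m)
    then have "m < n" by simp
    note v = val[OF this, of x] val[OF this, of y] der[OF this, of x]
    have "(x - y) * (\<Sum>k<Suc m. poly (p k) x * poly (p k) y)
       = a m * (poly (p m) x * poly (p (m - 1)) y - poly (p (m - 1)) x * poly (p m) y)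
         + (x * poly (p m) x) * poly (p m) y - poly (p m) x * (y * poly (p m) y)"
      using Suc by (simp add: algebra_simps)
    also have "\<dots> = a (Suc m) * (poly (p (Suc m)) x * poly (p m) y - poly (p m) x * poly (p (Suc m)) y)"
      unfolding v by (simp add: algebra_simps)
    finally have 1: "(x - y) * (\<Sum>k<Suc m. poly (p k) x * poly (p k) y) = \<dots>" .
    have "(\<Sum>k<Suc m. (poly (p k) x)\<^sup>2)
       = a m * (poly (pderiv (p m)) x * poly (p (m - 1)) x - poly (pderiv (p (m - 1))) x * poly (p m) x)
         + (poly (p m) x + x * poly (pderiv (p m)) x) * poly (p m) x
         - poly (pderiv (p m)) x * (x * poly (p m) x)"
      using Suc by (simp add: algebra_simps power2_eq_square)
    also have "\<dots> = a (Suc m) * (poly (pderiv (p (Suc m))) x * poly (p m) x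
                      - poly (pderiv (p m)) x * poly (p (Suc m)) x)"
      unfolding v by (simp add: algebra_simps)
    finally show ?case using 1 by simp
  qed
  then show "(x - y) * (\<Sum>k<n. poly (p k) x * poly (p k) y)
           = a n * (poly (p n) x * poly (p (n - 1)) y - poly (p (n - 1)) x * poly (p n) y)"
    and "(\<Sum>k<n. (poly (p k) x)\<^sup>2)
           = a n * (poly (pderiv (p n)) x * poly (p (n - 1)) x
                      - poly (pderiv (p (n - 1))) x * poly (p n) x)" by auto
qed

section \<open>Sign pattern and factorization at ordered zeros\<close>

lemma sgn_prod_diff:
  fixes z :: "nat \<Rightarrow> real"
  assumes "strict_mono_on {..<N} z" "i < N"
  shows "sgn (\<Prod>l\<in>{..<N} - {i}. z i - z l) = (-1) ^ (N - 1 - i)"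
proof -
  have split: "{..<N} - {i} = {..<i} \<union> {i<..<N}" using \<open>i < N\<close> by auto
  have lt: "z k < z l" if "k < l" "l < N" for k l
    using assms(1) that by (auto simp: strict_mono_on_def)
  have "(\<Prod>l<i. z i - z l) > 0" using lt \<open>i < N\<close> by (intro prod_pos) auto
  moreover have "sgn (\<Prod>l\<in>{i<..<N}. z i - z l) = (-1) ^ (N - 1 - i)"
  proof -
    have "sgn (\<Prod>l\<in>J. z i - z l) = (-1) ^ card J" if "finite J" "J \<subseteq> {i<..<N}" for J
      using that by (induction J rule: finite_induct) (auto simp: sgn_mult lt)
    from this[of "{i<..<N}"] show ?thesis by simp
  qed
  ultimately show ?thesis
    unfolding split by (subst prod.union_disjoint) (auto simp: sgn_mult)
qed

text \<open>\<open>ordered_zeros\<close> says nothing about multiplicities; simplicity follows by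
  counting, since \<open>N\<close> distinct roots exhaust the degree.\<close>

lemma ordered_zeros_factor:
  assumes "ordered_zeros p N z" "degree p = N" "p \<noteq> 0"
  shows "p = Polynomial.smult (lead_coeff p) (\<Prod>l<N. [:- z l, 1:])"
proof (rule poly_eqI_degree_lead_coeff)
  have z: "inj_on z {..<N}" "z ` {..<N} = {x. poly p x = 0}"
    using assms(1) by (auto simp: ordered_zeros_def strict_mono_on_imp_inj_on)
  show "card (z ` {..<N}) \<ge> N" using z(1) by (simp add: card_image)
  show "degree p \<le> N" using assms by simp
  have d: "degree (\<Prod>l<N. [:- z l, 1:]) = N" 
    using degree_prod_eq_sum_degree[of "{..<N}" "\<lambda>l. [:- z l, 1:]"] by simp
  show "degree (Polynomial.smult (lead_coeff p) (\<Prod>l<N. [:- z l, 1:])) \<le> N"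
    using degree_smult_le d by metis
  have "lead_coeff (\<Prod>l<N. [:- z l, 1:]) = 1"
    by (simp add: lead_coeff_prod)
  then show "coeff p N = coeff (Polynomial.smult (lead_coeff p) (\<Prod>l<N. [:- z l, 1:])) N"
    using assms(2) d by simp
  show "poly p x = poly (Polynomial.smult (lead_coeff p) (\<Prod>l<N. [:- z l, 1:])) x" if "x \<in> z ` {..<N}" for x
    using that z(2) by (force simp: poly_prod_linear)
qed

text \<open>What the three families share: orthonormality appears as the symmetric recurrence, and
  \<open>c\<close> is the ladder constant. Positivity is imposed on the product
  \<open>a N * c\<close> only, because for Laguerre both factors are negative: the leading
  coefficients alternate in sign.\<close>

locale classical_orthonormal =
  fixes N :: nat and z :: "nat \<Rightarrow> real" and p :: "nat \<Rightarrow> real poly" and A B :: "real poly"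
    and C :: real and \<mu> a b :: "nat \<Rightarrow> real" and c :: real
  assumes mono: "strict_mono_on {..<N} z"
    and p_N: "p N = Polynomial.smult C (\<Prod>l<N. [:- z l, 1:])"
    and C_nz: "C \<noteq> 0"
    and odes: "\<And>k. k \<le> N \<Longrightarrow> ode A B (\<mu> k) (p k)"
    and deg: "\<And>k. k < N \<Longrightarrow> degree (p k) \<le> k"
    and A_pos: "\<And>i. i < N \<Longrightarrow> poly A (z i) > 0"
    and a0: "a 0 = 0"
    and three_term: "\<And>k. k < N \<Longrightarrow> [:0, 1:] * p k
      = Polynomial.smult (a (Suc k)) (p (Suc k)) + Polynomial.smult (b k) (p k)
          + Polynomial.smult (a k) (p (k - 1))"
    and deriv_rel: "\<And>i. i < N \<Longrightarrow> poly A (z i) * poly (pderiv (p N)) (z i) = c * poly (p (N - 1)) (z i)"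
    and kappa_pos: "a N * c > 0"

sublocale classical_orthonormal \<subseteq> simple_zeros_ode N z "p N" A B C "\<mu> N"
  using mono C_nz odes[of N] A_pos
  by unfold_locales (auto simp: strict_mono_on_imp_inj_on p_N less_imp_neq[THEN not_sym])

context classical_orthonormal
begin

definition \<kappa> :: real where "\<kappa> = a N * c"

definition w :: "nat \<Rightarrow> real" where "w i = sqrt (poly A (z i))"

text \<open>By \<open>deriv_rel\<close> this is, up to the constant
  \<open>c / sqrt \<kappa>\<close>, the eigenvector \<open>p k / P'\<close> of \<open>T\<close>
  divided by \<open>w\<close>, hence an eigenvector of the conjugate
  \<open>T i j * w j / w i\<close>. The factor \<open>sqrt \<kappa>\<close> makes the rows unit
  vectors.\<close>

definition U :: "nat \<Rightarrow> nat \<Rightarrow> real" where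
  "U i k = w i * poly (p k) (z i) / (sqrt \<kappa> * poly (p (N - 1)) (z i))"

lemma w_pos: "i < N \<Longrightarrow> w i > 0"
  by (simp add: w_def A_pos)

lemma w_sq: "i < N \<Longrightarrow> (w i)\<^sup>2 = poly A (z i)"
  by (simp add: w_def A_pos less_imp_le)

lemma \<kappa>_pos: "\<kappa> > 0"
  using kappa_pos by (simp add: \<kappa>_def)

lemma c_nz: "c \<noteq> 0"
  using kappa_pos by auto

lemma p_zero: "i < N \<Longrightarrow> poly (p N) (z i) = 0"
  by (auto simp: p_N poly_prod_linear)

lemma p_penultimate: "i < N \<Longrightarrow> poly (p (N - 1)) (z i) = poly A (z i) * P' i / c"
  using deriv_rel[of i] c_nz by (simp add: P'_def field_simps)

lemma p_penultimate_nz: "i < N \<Longrightarrow> poly (p (N - 1)) (z i) \<noteq> 0"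
  using p_penultimate[of i] P'_nz[of i] A_nz[of i] c_nz by simp

text \<open>The Christoffel--Darboux expressions contain \<open>p N\<close>, which vanishes at the
  zeros; on the diagonal its derivative survives, and \<open>deriv_rel\<close> turns it into
  \<open>p (N - 1)\<close>.\<close>

lemma kernel:
  assumes "i < N" "j < N"
  shows "(\<Sum>k<N. poly (p k) (z i) * poly (p k) (z j))
           = (if i = j then \<kappa> * (poly (p (N - 1)) (z i))\<^sup>2 / poly A (z i) else 0)"
proof -
  note cd = christoffel_darboux[of a N p b, OF a0 three_term]
  show ?thesis
  proof (cases "i = j")
    case True
    have "(\<Sum>k<N. (poly (p k) (z i))\<^sup>2) = a N * (poly (pderiv (p N)) (z i) * poly (p (N - 1)) (z i))"
      using cd(2)[of "z i"] by (simp add: p_zero assms)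
    also have "poly (pderiv (p N)) (z i) = c * poly (p (N - 1)) (z i) / poly A (z i)"
      using deriv_rel[OF assms(1)] A_nz[OF assms(1)] by (simp add: field_simps)
    finally show ?thesis using True by (simp add: \<kappa>_def power2_eq_square mult.assoc)
  next
    case False
    then show ?thesis
      using cd(1)[of "z i" "z j"] z_neq[OF assms] by (simp add: p_zero assms)
  qed
qed

lemma U_orthogonal:
  assumes "i < N" "j < N"
  shows "(\<Sum>k<N. U i k * U j k) = (if i = j then 1 else 0)"
proof -
  have "(\<Sum>k<N. U i k * U j k) = w i * w j / (\<kappa> * poly (p (N - 1)) (z i) * poly (p (N - 1)) (z j))
          * (\<Sum>k<N. poly (p k) (z i) * poly (p k) (z j))"
    unfolding U_def sum_distrib_left using \<kappa>_pos
    by (intro sum.cong refl) (simp add: field_simps flip: power2_eq_square)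
  also have "\<dots> = (if i = j then 1 else 0)"
  proof (cases "i = j")
    case True
    then show ?thesis
      using \<kappa>_pos p_penultimate_nz[OF assms(1)] A_nz[OF assms(1)] w_sq[OF assms(1)] 
      by (simp add: kernel assms) (simp add: power2_eq_square)
  next
    case False
    then show ?thesis by (simp add: kernel assms)
  qed
  finally show ?thesis .
qed

lemma T_U:
  assumes "i < N" "k < N"
  shows "(\<Sum>j<N. T i j * w j / w i * U j k) = (\<mu> N - \<mu> k) * U i k"
proof -
  have U: "U j k = c / sqrt \<kappa> * (poly (p k) (z j) / P' j) / w j" if "j < N" for j
  proof -
    have "poly A (z j) = w j * w j" using w_sq[OF that] by (simp add: power2_eq_square)
    then show ?thesis
      using w_pos[OF that] c_nz unfolding U_def p_penultimate[OF that] by (simp add: mult_ac)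
  qed
  have "(\<Sum>j<N. T i j * w j / w i * U j k)
      = c / sqrt \<kappa> / w i * (\<Sum>j<N. T i j * (poly (p k) (z j) / P' j))"
    unfolding sum_distrib_left using w_pos by (intro sum.cong refl) (simp add: U less_imp_neq[THEN not_sym] mult_ac)
  also have "(\<Sum>j<N. T i j * (poly (p k) (z j) / P' j)) = (\<mu> N - \<mu> k) * (poly (p k) (z i) / P' i)"
    using assms deg[of k] odes[of k] by (intro T_eigenvector) auto
  finally show ?thesis using assms by (simp add: U mult_ac)
qed

text \<open>At the zeros \<open>p (N - 1)\<close> has the alternating sign of \<open>P'\<close> up
  to \<open>sgn c\<close>; the signs of \<open>C\<close> and \<open>c\<close> occur twice in the
  product and cancel.\<close>

lemma sgn_penultimate:
  assumes "i < N" "j < N"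
  shows "sgn (poly (p (N - 1)) (z i) * poly (p (N - 1)) (z j)) = (-1) ^ (i + j)"
proof -
  have s: "sgn (poly (p (N - 1)) (z i)) = sgn C * sgn c * (-1) ^ (N - 1 - i)" if "i < N" for i
  proof -
    have "sgn (poly (p (N - 1)) (z i))
        = sgn (poly A (z i)) * (sgn C * sgn (\<Prod>l\<in>{..<N} - {i}. z i - z l)) / sgn c"
      unfolding p_penultimate[OF that] P'_eq[OF that] sgn_mult sgn_divide ..
    moreover have "x / sgn c = x * sgn c" for x
      using c_nz by (simp add: sgn_if)
    ultimately show ?thesis
      using A_pos[OF that] by (simp add: sgn_prod_diff[OF mono that])
  qed
  have "even (N - 1 - i + (N - 1 - j)) \<longleftrightarrow> even (i + j)" using assms by auto
  then have "(-1 :: real) ^ (N - 1 - i + (N - 1 - j)) = (-1) ^ (i + j)"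
    by (simp add: minus_one_power_iff)
  moreover have "sgn C * sgn C = 1" "sgn c * sgn c = 1" using C_nz c_nz by (auto simp: sgn_if)
  ultimately show ?thesis
    unfolding sgn_mult s[OF assms(1)] s[OF assms(2)] by (simp add: power_add algebra_simps)
qed

end

section \<open>Spectral inversion of the matrix\<close>

text \<open>\<open>Sigma_mat\<close> is a definite description. For square matrices a right inverse
  is two-sided and unique, so exhibiting one both evaluates the description and proves
  invertibility.\<close>

lemma inverse_mat_unique:
  fixes M G :: "real mat"
  assumes "M \<in> carrier_mat n n" "G \<in> carrier_mat n n" "M * G = 1\<^sub>m n"
  shows "invertible_mat M"
    and "(THE X. X \<in> carrier_mat n n \<and> inverts_mat M X \<and> inverts_mat X M) = G"
proof -
  have GM: "G * M = 1\<^sub>m n" by (rule mat_mult_left_right_inverse[OF assms])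
  have G: "inverts_mat M G" "inverts_mat G M"
    using assms GM by (auto simp: inverts_mat_def)
  then show "invertible_mat M" using assms by (auto simp: invertible_mat_def)
  show "(THE X. X \<in> carrier_mat n n \<and> inverts_mat M X \<and> inverts_mat X M) = G"
  proof (rule the_equality)
    show "G \<in> carrier_mat n n \<and> inverts_mat M G \<and> inverts_mat G M" using G assms by simp
    fix X assume X: "X \<in> carrier_mat n n \<and> inverts_mat M X \<and> inverts_mat X M"
    then have XM: "X * M = 1\<^sub>m n" by (auto simp: inverts_mat_def)
    from X have Xc: "X \<in> carrier_mat n n" by simp
    have "X = X * (M * G)" unfolding assms(3) by (rule right_mult_one_mat[OF Xc, symmetric])
    also have "\<dots> = (X * M) * G" using X assms by (intro assoc_mult_mat[symmetric]) auto
    also have "\<dots> = G" using XM assms by simp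
    finally show "X = G" .
  qed
qed

context classical_orthonormal
begin

text \<open>\<open>U\<close> is orthogonal and diagonalizes the symmetric matrix \<open>s\<close>, so \<open>s\<close> is inverted on its
  spectral decomposition.\<close>

theorem inverse_formula:
  fixes s :: "nat \<Rightarrow> nat \<Rightarrow> real" and g :: real
  assumes s: "\<And>i j. i < N \<Longrightarrow> j < N \<Longrightarrow> s i j = g * (T i j * w j / w i)"
    and L: "\<And>k. k < N \<Longrightarrow> L k = g * (\<mu> N - \<mu> k)"
    and L_nz: "\<And>k. k < N \<Longrightarrow> L k \<noteq> 0"
  defines "M \<equiv> Matrix.mat N N (\<lambda>(i, j). s i j)"
  defines "M' \<equiv> (THE X. X \<in> carrier_mat N N \<and> inverts_mat M X \<and> inverts_mat X M)"
  shows "invertible_mat M"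
    and "\<lbrakk>i < N; j < N\<rbrakk> \<Longrightarrow> M' $$ (i, j) = sqrt (poly A (z i) * poly A (z j)) /
           (\<kappa> * poly (p (N - 1)) (z i) * poly (p (N - 1)) (z j)) *
         (\<Sum>k<N. poly (p k) (z i) * poly (p k) (z j) / L k)"
    and "\<lbrakk>i < N; j < N\<rbrakk> \<Longrightarrow> M' $$ (i, j) = (-1) ^ (i + j) /
           sqrt (\<Sum>k<N. \<Sum>l<N. (poly (p k) (z i))\<^sup>2 * (poly (p l) (z j))\<^sup>2) *
         (\<Sum>k<N. poly (p k) (z i) * poly (p k) (z j) / L k)"
proof -
  define G where "G = Matrix.mat N N (\<lambda>(i, j). \<Sum>k<N. U i k * U j k / L k)"
  have carr: "M \<in> carrier_mat N N" "G \<in> carrier_mat N N" by (simp_all add: M_def G_def)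
  have "M * G = 1\<^sub>m N"
  proof (rule eq_matI)
    fix i j assume "i < dim_row (1\<^sub>m N :: real mat)" "j < dim_col (1\<^sub>m N :: real mat)"
    then have ij: "i < N" "j < N" by auto
    have "(M * G) $$ (i, j) = (\<Sum>m<N. s i m * (\<Sum>k<N. U m k * U j k / L k))"
      using ij by (simp add: M_def G_def scalar_prod_def atLeast0LessThan)
    \<comment> \<open>With the sum over \<open>m\<close> inside, the matrix acts on one eigenvector
      at a time and its eigenvalue cancels against \<open>L k\<close>; what remains is the product
      of two rows of \<open>U\<close>.\<close>
    also have "\<dots> = (\<Sum>k<N. \<Sum>m<N. s i m * (U m k * U j k / L k))"
      unfolding sum_distrib_left by (rule sum.swap)
    also have "\<dots> = (\<Sum>k<N. U i k * U j k)"
    proof (intro sum.cong refl)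
      fix k assume "k \<in> {..<N}"
      then have k: "k < N" by simp
      have "(\<Sum>m<N. s i m * (U m k * U j k / L k))
          = g * (\<Sum>m<N. T i m * w m / w i * U m k) * U j k / L k"
        unfolding sum_distrib_left sum_distrib_right sum_divide_distrib
        using ij by (intro sum.cong refl) (simp add: s mult_ac)
      also have "\<dots> = U i k * U j k"
        unfolding T_U[OF ij(1) k] using L[OF k] L_nz[OF k] by simp
      finally show "(\<Sum>m<N. s i m * (U m k * U j k / L k)) = U i k * U j k" .
    qed
    finally show "(M * G) $$ (i, j) = 1\<^sub>m N $$ (i, j)" by (simp add: U_orthogonal ij)
  qed (auto simp: M_def G_def)
  note inv = inverse_mat_unique[OF carr this]
  show "invertible_mat M" by (rule inv)
  assume ij: "i < N" "j < N"
  define q where "q i = poly (p (N - 1)) (z i)" for i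
  define K where "K = (\<Sum>k<N. poly (p k) (z i) * poly (p k) (z j) / L k)"
  have w: "sqrt (poly A (z i) * poly A (z j)) = w i * w j"
    by (simp add: w_def real_sqrt_mult)
  have "M' $$ (i, j) = (\<Sum>k<N. U i k * U j k / L k)"
    using ij unfolding M'_def inv(2) by (simp add: G_def)
  also have "\<dots> = w i * w j / (\<kappa> * q i * q j) * K"
    unfolding U_def q_def[symmetric] sum_distrib_left K_def using \<kappa>_pos
    by (intro sum.cong refl) (simp add: field_simps flip: power2_eq_square)
  finally have M': "M' $$ (i, j) = w i * w j / (\<kappa> * q i * q j) * K" .
  then show "M' $$ (i, j) = sqrt (poly A (z i) * poly A (z j)) /
           (\<kappa> * poly (p (N - 1)) (z i) * poly (p (N - 1)) (z j)) *
         (\<Sum>k<N. poly (p k) (z i) * poly (p k) (z j) / L k)"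
    by (simp add: w q_def K_def)
  \<comment> \<open>The diagonal kernel evaluates both factors of the double sum, so its square root
    is the reciprocal of the prefactor of the first formula up to an absolute value.\<close>
  have sq: "(\<Sum>k<N. (poly (p k) (z i))\<^sup>2) = \<kappa> * (q i)\<^sup>2 / (w i)\<^sup>2" if "i < N" for i
    using kernel[OF that that] w_sq[OF that] by (simp add: q_def power2_eq_square)
  have "(\<Sum>k<N. \<Sum>l<N. (poly (p k) (z i))\<^sup>2 * (poly (p l) (z j))\<^sup>2)
      = (\<kappa> * (q i)\<^sup>2 / (w i)\<^sup>2) * (\<kappa> * (q j)\<^sup>2 / (w j)\<^sup>2)"
    by (simp only: sum_product[symmetric] sq ij)
  also have "\<dots> = (\<kappa> * \<bar>q i * q j\<bar> / (w i * w j))\<^sup>2"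
    by (simp add: power_mult_distrib power_divide abs_mult) (simp add: power2_eq_square)
  finally have "sqrt (\<Sum>k<N. \<Sum>l<N. (poly (p k) (z i))\<^sup>2 * (poly (p l) (z j))\<^sup>2)
      = \<kappa> * \<bar>q i * q j\<bar> / (w i * w j)"
    using \<kappa>_pos w_pos[OF ij(1)] w_pos[OF ij(2)] by simp
  moreover have "\<bar>q i * q j\<bar> = q i * q j * (-1) ^ (i + j)"
    using sgn_penultimate[OF ij] unfolding q_def abs_sgn by simp
  moreover have "w i * w j / (\<kappa> * q i * q j) = (-1) ^ (i + j) / (\<kappa> * (q i * q j * (-1) ^ (i + j)) / (w i * w j))"
    by (cases "even (i + j)") auto
  ultimately show "M' $$ (i, j) = (-1) ^ (i + j) /
           sqrt (\<Sum>k<N. \<Sum>l<N. (poly (p k) (z i))\<^sup>2 * (poly (p l) (z j))\<^sup>2) *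
         (\<Sum>k<N. poly (p k) (z i) * poly (p k) (z j) / L k)"
    unfolding M' K_def by simp
qed

end

text \<open>The interface for the case distinction: besides the recurrence data a family supplies
  one scale \<open>g\<close>, by which the entries of \<open>S\<close> and the numbers
  \<open>lam\<close> are multiples of the conjugated \<open>T\<close> and its eigenvalues.\<close>

lemma covariance_from_classical:
  fixes E :: ensemble
  assumes "classical_orthonormal N z (onp E) A B C \<mu> a b c" "N > 0"
    and \<kappa>: "a N * c = kappa E N"
    and A: "\<And>x. poly A x = pi_fun E x"
    and s: "\<And>i j. i < N \<Longrightarrow> j < N \<Longrightarrow>
      s_entry E N z i j = g * (simple_zeros_ode.T N z A B i j * sqrt (pi_fun E (z j)) / sqrt (pi_fun E (z i)))"
    and L: "\<And>k. k < N \<Longrightarrow> lam E N (N - k) = g * (\<mu> N - \<mu> k)"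
    and L_nz: "\<And>k. k < N \<Longrightarrow> lam E N (N - k) \<noteq> 0"
  shows "invertible_mat (S_mat E N z) \<and>
    (\<forall>i<N. \<forall>j<N.
       Sigma_mat E N z $$ (i, j) =
         sqrt (pi_fun E (z i) * pi_fun E (z j)) /
           (kappa E N * poly (onp E (N - 1)) (z i) * poly (onp E (N - 1)) (z j)) *
         (\<Sum>k = 0..N - 1. poly (onp E k) (z i) * poly (onp E k) (z j) / lam E N (N - k))
     \<and> Sigma_mat E N z $$ (i, j) =
         (-1) ^ (i + j) /
           sqrt (\<Sum>k = 0..N - 1. \<Sum>l = 0..N - 1.
                   (poly (onp E k) (z i))\<^sup>2 * (poly (onp E l) (z j))\<^sup>2) *
         (\<Sum>k = 0..N - 1. poly (onp E k) (z i) * poly (onp E k) (z j) / lam E N (N - k)))"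
proof -
  interpret classical_orthonormal N z "onp E" A B C \<mu> a b c by fact
  have rng: "{0..N - 1} = {..<N}" using \<open>N > 0\<close> by auto
  have s': "s_entry E N z i j = g * (T i j * w j / w i)" if "i < N" "j < N" for i j
    using s[OF that] by (simp add: w_def A)
  note inv = inverse_formula[of "s_entry E N z" g "\<lambda>k. lam E N (N - k)", OF s' L L_nz,
      folded S_mat_def, folded Sigma_mat_def, unfolded \<kappa>_def \<kappa> A]
  show ?thesis unfolding rng using inv by blast
qed

section \<open>Hermite polynomials\<close>

lemma pderiv_hermite: "pderiv (hermite_poly k) = Polynomial.smult (2 * real k) (hermite_poly (k - 1))"
proof (induction k)
  case (Suc k)
  define H' where "H' = hermite_poly (k - 1)"
  \<comment> \<open>At \<open>k = 0\<close> the index \<open>k - 1\<close> is \<open>0\<close> and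
    the recursion does not apply, but the factor \<open>2 * real k\<close> vanishes.\<close>
  have "Polynomial.smult (2 * real k) ([:0, 2:] * H' - pderiv H')
      = Polynomial.smult (2 * real k) (hermite_poly k)"
    by (cases k) (simp_all add: H'_def)
  then have *: "[:0, 2:] * Polynomial.smult (2 * real k) H' - Polynomial.smult (2 * real k) (pderiv H')
      = Polynomial.smult (2 * real k) (hermite_poly k)"
    by (simp only: smult_diff_right mult_smult_right)
  have "pderiv (hermite_poly (Suc k)) = Polynomial.smult 2 (hermite_poly k)
      + ([:0, 2:] * Polynomial.smult (2 * real k) H' - Polynomial.smult (2 * real k) (pderiv H'))"
    by (simp add: pderiv_mult pderiv_diff pderiv_pCons Suc.IH pderiv_smult H'_def)
  also have "\<dots> = Polynomial.smult (2 * real (Suc k)) (hermite_poly k)"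
    unfolding * by (simp add: smult_add_left[symmetric] algebra_simps)
  finally show ?case by simp
qed simp

lemma hermite_three_term:
  "[:0, 2:] * hermite_poly k = hermite_poly (Suc k) + Polynomial.smult (2 * real k) (hermite_poly (k - 1))"
  by (simp add: pderiv_hermite)

declare hermite_poly.simps(2) [simp del]

lemma degree_hermite: "degree (hermite_poly k) = k"
proof -
  have "degree (hermite_poly k) \<le> k \<and> coeff (hermite_poly k) k = 2 ^ k"
  proof (induction k)
    case (Suc k)
    have "degree ([:0, 2:] * hermite_poly k) \<le> Suc k"
      using degree_mult_le[of "[:0, 2:]" "hermite_poly k"] Suc by simp
    moreover have "degree (pderiv (hermite_poly k)) \<le> k"
      using Suc degree_pderiv[of "hermite_poly k"] by linarith
    moreover have "coeff (pderiv (hermite_poly k)) (Suc k) = 0"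
      using Suc by (simp add: coeff_pderiv coeff_eq_0)
    ultimately show ?case
      using Suc by (auto simp: hermite_poly.simps intro!: degree_diff_le)
  qed simp
  then show ?thesis using le_degree[of "hermite_poly k" k] by force
qed

text \<open>Differentiate the lowering relation \<open>pderiv_hermite\<close> and replace the
  derivative of the lower polynomial by the defining recursion.\<close>

lemma ode_hermite: "ode 1 [:0, -2:] (2 * real k) (hermite_poly k)"
proof (cases k)
  case 0
  then show ?thesis by (simp add: ode_def)
next
  case (Suc m)
  have "pderiv (pderiv (hermite_poly (Suc m)))
      = Polynomial.smult (2 * real (Suc m)) (pderiv (hermite_poly m))"
    by (simp only: pderiv_hermite[of "Suc m"] pderiv_smult diff_Suc_1)
  also have "pderiv (hermite_poly m) = [:0, 2:] * hermite_poly m - hermite_poly (Suc m)"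
    by (simp add: hermite_poly.simps)
  finally show ?thesis
    unfolding ode_def Suc pderiv_hermite[of "Suc m"]
    by (simp add: smult_diff_right)
qed

text \<open>The ratio of consecutive normalizing constants is what rescales the recurrence and the
  lowering relation to orthonormal form.\<close>

lemma hermite_onp_eq:
  obtains n where "\<And>k. hermite_onp k = Polynomial.smult (n k) (hermite_poly k)"
    "\<And>k. n k > 0" "\<And>k. n k = sqrt (2 * real (Suc k)) * n (Suc k)"
proof
  define n where "n k = 1 / (2 powr (real k / 2) * sqrt (fact k))" for k
  show "hermite_onp k = Polynomial.smult (n k) (hermite_poly k)" for k
    by (simp add: hermite_onp_def n_def)
  show "n k > 0" for k by (simp add: n_def)
  show "n k = sqrt (2 * real (Suc k)) * n (Suc k)" for k
  proof -
    have "2 powr (real (Suc k) / 2) = sqrt 2 * 2 powr (real k / 2)"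
      by (simp add: powr_add[symmetric] powr_half_sqrt[symmetric] add_divide_distrib)
    moreover have "sqrt (fact (Suc k)) = sqrt (real (Suc k)) * sqrt (fact k)"
      by (simp only: fact_Suc real_sqrt_mult)
    moreover have "sqrt (real (Suc k)) \<noteq> 0" by simp
    ultimately show ?thesis
      unfolding n_def real_sqrt_mult by (simp del: of_nat_Suc fact_Suc)
  qed
qed

lemma classical_orthonormal_hermite:
  assumes "N > 0" "ordered_zeros (hermite_poly N) N z"
  shows "\<exists>C c. classical_orthonormal N z hermite_onp 1 [:0, -2:] C (\<lambda>k. 2 * real k)
           (\<lambda>k. sqrt (real k / 2)) (\<lambda>_. 0) c \<and> sqrt (real N / 2) * c = real N"
proof -
  obtain n where n: "\<And>k. hermite_onp k = Polynomial.smult (n k) (hermite_poly k)"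
    and n_pos: "\<And>k. n k > 0" and n_Suc: "\<And>k. n k = sqrt (2 * real (Suc k)) * n (Suc k)"
    using hermite_onp_eq by metis
  have nz: "hermite_poly k \<noteq> 0" for k
    using degree_hermite[of k] by (cases "k = 0") auto
  show ?thesis
  proof (intro exI conjI)
    show "sqrt (real N / 2) * sqrt (2 * real N) = real N"
      by (simp add: real_sqrt_mult[symmetric])
    show "classical_orthonormal N z hermite_onp 1 [:0, -2:] (n N * lead_coeff (hermite_poly N))
            (\<lambda>k. 2 * real k) (\<lambda>k. sqrt (real k / 2)) (\<lambda>_. 0) (sqrt (2 * real N))"
    proof
      show "strict_mono_on {..<N} z" using assms(2) by (simp add: ordered_zeros_def)
      show "hermite_onp N = Polynomial.smult (n N * lead_coeff (hermite_poly N)) (\<Prod>l<N. [:- z l, 1:])"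
        by (subst n, subst ordered_zeros_factor[OF assms(2) degree_hermite nz]) simp
      show "n N * lead_coeff (hermite_poly N) \<noteq> 0" using n_pos[of N] nz by simp
      show "ode 1 [:0, - 2:] (2 * real k) (hermite_onp k)" for k
        unfolding n by (intro ode_smult ode_hermite)
      show "degree (hermite_onp k) \<le> k" for k
        unfolding n by (rule order.trans[OF degree_smult_le]) (simp add: degree_hermite)
      show "[:0, 1:] * hermite_onp k = Polynomial.smult (sqrt (real (Suc k) / 2)) (hermite_onp (Suc k))
          + Polynomial.smult 0 (hermite_onp k) + Polynomial.smult (sqrt (real k / 2)) (hermite_onp (k - 1))" for k
      proof -
        have sqrt_half: "sqrt (x / 2) = sqrt (2 * x) / 2" for x
          by (simp add: real_sqrt_mult real_sqrt_divide field_simps)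
        have 1: "sqrt (real (Suc k) / 2) * n (Suc k) = n k / 2"
          by (subst (2) n_Suc) (simp add: sqrt_half del: of_nat_Suc)
        have 2: "sqrt (real k / 2) * n (k - 1) = n k * real k"
        proof (cases k)
          case (Suc m)
          then have "sqrt (real k / 2) * n (k - 1) = (sqrt (2 * real k) * sqrt (2 * real k)) / 2 * n k"
            using n_Suc[of m] by (simp add: sqrt_half)
          then show ?thesis by simp
        qed simp
        have 3: "[:0, 1:] * hermite_onp k = Polynomial.smult (n k / 2) ([:0, 2:] * hermite_poly k)"
          by (simp add: n)
        show ?thesis
          unfolding 3 hermite_three_term unfolding n smult_add_right smult_smult 1 2 by simp
      qed
      show "poly 1 (z i) * poly (pderiv (hermite_onp N)) (z i)
          = sqrt (2 * real N) * poly (hermite_onp (N - 1)) (z i)" for i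
        using \<open>N > 0\<close> n_Suc[of "N - 1"] by (simp add: n pderiv_smult pderiv_hermite mult.assoc[symmetric])
      show "sqrt (real N / 2) * sqrt (2 * real N) > 0" using assms by simp
    qed auto
  qed
qed

lemma hermite_spectral_data:
  assumes "N > 0" "ordered_zeros (hermite_poly N) N z"
  obtains A B C \<mu> a b c g where "classical_orthonormal N z (onp Hermite) A B C \<mu> a b c"
    "a N * c = kappa Hermite N"
    "\<And>x. poly A x = pi_fun Hermite x"
    "\<And>i j. i < N \<Longrightarrow> j < N \<Longrightarrow>
      s_entry Hermite N z i j
        = g * (simple_zeros_ode.T N z A B i j * sqrt (pi_fun Hermite (z j)) / sqrt (pi_fun Hermite (z i)))"
    "\<And>k. k < N \<Longrightarrow> lam Hermite N (N - k) = g * (\<mu> N - \<mu> k)"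
    "\<And>k. k < N \<Longrightarrow> lam Hermite N (N - k) \<noteq> 0"
proof -
  obtain C c where co: "classical_orthonormal N z hermite_onp 1 [:0, -2:] C (\<lambda>k. 2 * real k)
      (\<lambda>k. sqrt (real k / 2)) (\<lambda>_. 0) c" and \<kappa>: "sqrt (real N / 2) * c = real N"
    using classical_orthonormal_hermite[OF assms] by auto
  interpret classical_orthonormal N z hermite_onp 1 "[:0, -2:]" C "\<lambda>k. 2 * real k"
    "\<lambda>k. sqrt (real k / 2)" "\<lambda>_. 0" c by fact
  have onp: "onp Hermite = hermite_onp" by (simp add: fun_eq_iff)
  \<comment> \<open>Here \<open>g = 1 / 2\<close>: the entries of \<open>T\<close> carry a factor
    \<open>2\<close>, and the Hermite eigenvalues are \<open>2 k\<close> while \<open>lam\<close> is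
    \<open>k\<close>.\<close>
  show ?thesis
    by (rule that[of 1 "[:0, -2:]" C "\<lambda>k. 2 * real k" "\<lambda>k. sqrt (real k / 2)" "\<lambda>_. 0" c "1 / 2"])
      (auto simp: onp co \<kappa> T_def \<sigma>\<^sub>2_def pderiv_pCons of_nat_diff)
qed

section \<open>Laguerre polynomials\<close>

lemma coeff_laguerre:
  "coeff (laguerre_poly \<alpha> k) m
     = (if m \<le> k then (-1) ^ m * ((real k + \<alpha>) gchoose (k - m)) / fact m else 0)"
  unfolding laguerre_poly_def by (simp add: coeff_sum)

lemma gchoose_pos:
  assumes "a > real k - 1"
  shows "(a gchoose k) > 0"
  using assms unfolding gbinomial_prod_rev by (intro divide_pos_pos prod_pos) auto

text \<open>For \<open>x \<le> 0\<close> the alternating signs are absorbed into powers of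
  \<open>- x\<close>, so nothing cancels. Hence the zeros lie where \<open>\<pi>(x) = x\<close> is
  positive.\<close>

lemma laguerre_pos:
  assumes "\<alpha> > - 1" "x \<le> 0"
  shows "poly (laguerre_poly \<alpha> k) x > 0"
proof -
  have "poly (laguerre_poly \<alpha> k) x = (\<Sum>m\<le>k. ((real k + \<alpha>) gchoose (k - m)) / fact m * (- x) ^ m)"
    unfolding laguerre_poly_def poly_sum poly_monom
    by (intro sum.cong refl) (simp add: power_minus[of x])
  also have "\<dots> > 0"
  proof (rule sum_pos2[of _ 0])
    show "0 < ((real k + \<alpha>) gchoose (k - 0)) / fact 0 * (- x) ^ 0"
      using assms by (simp add: gchoose_pos)
    show "0 \<le> ((real k + \<alpha>) gchoose (k - m)) / fact m * (- x) ^ m" if "m \<in> {..k}" for m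
      using assms that by (intro mult_nonneg_nonneg divide_nonneg_nonneg less_imp_le[OF gchoose_pos]) (auto simp: of_nat_diff)
  qed auto
  finally show ?thesis .
qed

lemma degree_laguerre: "degree (laguerre_poly \<alpha> k) = k"
proof (rule antisym)
  show "degree (laguerre_poly \<alpha> k) \<le> k" by (rule degree_le) (simp add: coeff_laguerre)
  show "k \<le> degree (laguerre_poly \<alpha> k)" by (rule le_degree) (simp add: coeff_laguerre)
qed

lemma laguerre_0 [simp]: "laguerre_poly \<alpha> 0 = 1"
  by (simp add: laguerre_poly_def)

text \<open>Binomial absorption in each coefficient. The case \<open>k = 0\<close> suppresses the
  spurious index \<open>0 - 1 = 0\<close>. At a zero of the polynomial this becomes the ladder
  relation \<open>deriv_rel\<close>.\<close>

lemma laguerre_structure: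
  "[:0, 1:] * pderiv (laguerre_poly \<alpha> k) = Polynomial.smult (real k) (laguerre_poly \<alpha> k)
     - Polynomial.smult (if k = 0 then 0 else real k + \<alpha>) (laguerre_poly \<alpha> (k - 1))"
proof (cases k)
  case (Suc n)
  have "real m * coeff (laguerre_poly \<alpha> k) m
      = real k * coeff (laguerre_poly \<alpha> k) m - (real k + \<alpha>) * coeff (laguerre_poly \<alpha> n) m" for m
  proof (cases "m \<le> n")
    case True
    then have "(real k + \<alpha>) * ((real n + \<alpha>) gchoose (n - m)) = (real k - real m) * ((real k + \<alpha>) gchoose (k - m))"
      using gbinomial_absorption[of "n - m" "real k + \<alpha>"] Suc by (simp add: Suc_diff_le algebra_simps of_nat_diff)
    then have "(-1) ^ m / fact m * ((real k + \<alpha>) * ((real n + \<alpha>) gchoose (n - m)))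
        = (-1) ^ m / fact m * ((real k - real m) * ((real k + \<alpha>) gchoose (k - m)))"
      by simp
    then show ?thesis using True Suc by (simp add: coeff_laguerre algebra_simps diff_divide_distrib add_divide_distrib)
  next
    case False
    then show ?thesis using Suc by (cases "m = k") (auto simp: coeff_laguerre)
  qed
  note * = this
  show ?thesis
  proof (rule poly_eqI)
    show "coeff ([:0, 1:] * pderiv (laguerre_poly \<alpha> k)) m = coeff (Polynomial.smult (real k) (laguerre_poly \<alpha> k)
      - Polynomial.smult (if k = 0 then 0 else real k + \<alpha>) (laguerre_poly \<alpha> (k - 1))) m" for m
      using *[of m] Suc by (cases m) (auto simp: coeff_pCons coeff_pderiv)
  qed
qed simp

text \<open>Pascal's rule for generalized binomial coefficients, read off in each power.\<close>

lemma laguerre_lowering: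
  "pderiv (laguerre_poly \<alpha> (Suc k)) = pderiv (laguerre_poly \<alpha> k) - laguerre_poly \<alpha> k"
proof (rule poly_eqI)
  fix m
  have "((real (Suc k) + \<alpha>) gchoose (k - m)) = ((real k + \<alpha>) gchoose (k - m))
      + (if m < k then (real k + \<alpha>) gchoose (k - Suc m) else 0)" if "m \<le> k"
    using that gbinomial_Suc_Suc[of "real k + \<alpha>" "k - Suc m"]
    by (cases "m = k") (auto simp: Suc_diff_Suc algebra_simps)
  note pascal = this
  have *: "real (Suc m) * ((-1) ^ Suc m * x / fact (Suc m)) = - ((-1) ^ m / fact m) * x" for x :: real
    unfolding fact_Suc by (simp del: of_nat_Suc)
  have 1: "coeff (pderiv (laguerre_poly \<alpha> (Suc k))) m
      = (if m \<le> k then - ((-1) ^ m / fact m) * ((real (Suc k) + \<alpha>) gchoose (k - m)) else 0)"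
  proof (cases "m \<le> k")
    case True
    show ?thesis
      by (simp only: coeff_pderiv coeff_laguerre Suc_le_mono diff_Suc_Suc True if_True *)
  qed (simp add: coeff_pderiv coeff_laguerre)
  have 2: "coeff (pderiv (laguerre_poly \<alpha> k)) m
      = (if m < k then - ((-1) ^ m / fact m) * ((real k + \<alpha>) gchoose (k - Suc m)) else 0)"
  proof (cases "m < k")
    case True
    then show ?thesis
      by (simp only: coeff_pderiv coeff_laguerre Suc_le_eq if_True *)
  qed (simp add: coeff_pderiv coeff_laguerre)
  show "coeff (pderiv (laguerre_poly \<alpha> (Suc k))) m
      = coeff (pderiv (laguerre_poly \<alpha> k) - laguerre_poly \<alpha> k) m"
    unfolding coeff_diff 1 2 coeff_laguerre using pascal
    by (auto simp: distrib_left simp del: of_nat_Suc)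
qed

text \<open>Multiplying \<open>laguerre_lowering\<close> by \<open>x\<close> and applying
  \<open>laguerre_structure\<close> on both sides eliminates all derivatives.\<close>

lemma laguerre_three_term:
  "[:0, 1:] * laguerre_poly \<alpha> k = Polynomial.smult (- real (Suc k)) (laguerre_poly \<alpha> (Suc k))
     + Polynomial.smult (2 * real k + 1 + \<alpha>) (laguerre_poly \<alpha> k)
     + Polynomial.smult (if k = 0 then 0 else - (real k + \<alpha>)) (laguerre_poly \<alpha> (k - 1))"
proof -
  have "[:0, 1:] * pderiv (laguerre_poly \<alpha> (Suc k))
      = [:0, 1:] * pderiv (laguerre_poly \<alpha> k) - [:0, 1:] * laguerre_poly \<alpha> k"
    unfolding laguerre_lowering by (simp only: right_diff_distrib)
  then show ?thesis
    unfolding laguerre_structure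
    by (simp add: poly_eq_poly_eq_iff[symmetric] fun_eq_iff algebra_simps split: if_splits)
qed

text \<open>Differentiate \<open>laguerre_structure\<close>; \<open>laguerre_lowering\<close>
  removes the derivative of the lower polynomial, and \<open>laguerre_structure\<close> the lower
  polynomial itself.\<close>

lemma ode_laguerre: "ode [:0, 1:] [:\<alpha> + 1, -1:] (real k) (laguerre_poly \<alpha> k)"
proof (cases k)
  case 0
  then show ?thesis by (simp add: ode_def)
next
  case (Suc n)
  define L L0 where "L = laguerre_poly \<alpha> k" and "L0 = laguerre_poly \<alpha> n"
  have "pderiv ([:0, 1:] * pderiv L) = pderiv (Polynomial.smult (real k) L - Polynomial.smult (real k + \<alpha>) L0)"
    using laguerre_structure[of \<alpha> k] Suc by (simp add: L_def L0_def)
  then have 1: "pderiv L + [:0, 1:] * pderiv (pderiv L)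
      = Polynomial.smult (real k) (pderiv L) - Polynomial.smult (real k + \<alpha>) (pderiv L0)"
    by (simp add: pderiv_mult pderiv_pCons pderiv_diff pderiv_smult)
  have 2: "[:0, 1:] * pderiv L = Polynomial.smult (real k) L - Polynomial.smult (real k + \<alpha>) L0"
    using laguerre_structure[of \<alpha> k] Suc by (simp add: L_def L0_def)
  have 3: "pderiv L = pderiv L0 - L0"
    using laguerre_lowering[of \<alpha> n] Suc by (simp add: L_def L0_def)
  have "x * poly (pderiv (pderiv L)) x + (\<alpha> + 1 - x) * poly (pderiv L) x + real k * poly L x = 0" for x
  proof -
    define d' d e' e f where "d' = poly (pderiv (pderiv L)) x" and "d = poly (pderiv L) x"
      and "e' = poly (pderiv L0) x" and "e = poly L0 x" and "f = poly L x"
    have "d + x * d' = real k * d - (real k + \<alpha>) * e'"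
      using arg_cong[OF 1, of "\<lambda>q. poly q x"] by (simp add: d'_def d_def e'_def)
    moreover have "x * d = real k * f - (real k + \<alpha>) * e"
      using arg_cong[OF 2, of "\<lambda>q. poly q x"] by (simp add: d_def e_def f_def)
    moreover have "e' = d + e"
      using arg_cong[OF 3, of "\<lambda>q. poly q x"] by (simp add: d_def e_def e'_def)
    ultimately show ?thesis
      unfolding d'_def[symmetric] d_def[symmetric] f_def[symmetric] by (simp add: algebra_simps)
  qed
  then show ?thesis
    unfolding ode_def L_def[symmetric]
    by (simp add: poly_eq_poly_eq_iff[symmetric] fun_eq_iff algebra_simps)
qed


lemma laguerre_onp_eq:
  assumes "\<alpha> > - 1"
  obtains n where "\<And>k. laguerre_onp \<alpha> k = Polynomial.smult (n k) (laguerre_poly \<alpha> k)"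
    "\<And>k. n k > 0"
    "\<And>k. sqrt (real (Suc k)) * n k = sqrt (real (Suc k) + \<alpha>) * n (Suc k)"
proof
  define n where "n k = 1 / sqrt ((real k + \<alpha>) gchoose k)" for k
  show "laguerre_onp \<alpha> k = Polynomial.smult (n k) (laguerre_poly \<alpha> k)" for k
    by (simp add: laguerre_onp_def n_def)
  have pos: "((real k + \<alpha>) gchoose k) > 0" for k using assms by (intro gchoose_pos) simp
  show "n k > 0" for k using pos by (simp add: n_def)
  show "sqrt (real (Suc k)) * n k = sqrt (real (Suc k) + \<alpha>) * n (Suc k)" for k
  proof -
    have "((real (Suc k) + \<alpha>) gchoose Suc k) = (real (Suc k) + \<alpha>) / real (Suc k) * ((real k + \<alpha>) gchoose k)"
      using gbinomial_factors[of "real k + \<alpha>" k] by (simp add: add_ac)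
    then have "sqrt ((real (Suc k) + \<alpha>) gchoose Suc k)
        = sqrt (real (Suc k) + \<alpha>) / sqrt (real (Suc k)) * sqrt ((real k + \<alpha>) gchoose k)"
      by (simp only: real_sqrt_mult real_sqrt_divide)
    moreover have "sqrt (real (Suc k) + \<alpha>) > 0" "sqrt (real (Suc k)) > 0" using assms by auto
    ultimately show ?thesis unfolding n_def by (simp del: of_nat_Suc)
  qed
qed

lemma classical_orthonormal_laguerre:
  assumes "N > 0" "\<alpha> > - 1" "ordered_zeros (laguerre_poly \<alpha> N) N z"
  shows "\<exists>C c. classical_orthonormal N z (laguerre_onp \<alpha>) [:0, 1:] [:\<alpha> + 1, -1:] C real
           (\<lambda>k. - sqrt (real k * (real k + \<alpha>))) (\<lambda>k. 2 * real k + 1 + \<alpha>) c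
           \<and> - sqrt (real N * (real N + \<alpha>)) * c = real N * (real N + \<alpha>)"
proof -
  obtain n where n: "\<And>k. laguerre_onp \<alpha> k = Polynomial.smult (n k) (laguerre_poly \<alpha> k)"
    and n_pos: "\<And>k. n k > 0"
    and n_Suc: "\<And>k. sqrt (real (Suc k)) * n k = sqrt (real (Suc k) + \<alpha>) * n (Suc k)"
    using laguerre_onp_eq[OF assms(2)] by metis
  have nz: "laguerre_poly \<alpha> k \<noteq> 0" for k
    using degree_laguerre[of \<alpha> k] by (cases "k = 0") auto
  have pos: "real N + \<alpha> > 0" using assms by simp
  \<comment> \<open>\<open>up\<close> and \<open>down\<close> give both neighbours in the recurrence
    the same coefficient function \<open>sqrt (k * (k + \<alpha>))\<close>; \<open>down\<close> also
    yields the ladder constant.\<close>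
  have up: "sqrt (real (Suc k) * (real (Suc k) + \<alpha>)) * n (Suc k) = real (Suc k) * n k" for k
  proof -
    have "sqrt (real (Suc k) * (real (Suc k) + \<alpha>)) * n (Suc k)
        = sqrt (real (Suc k)) * (sqrt (real (Suc k)) * n k)"
      unfolding n_Suc by (simp only: real_sqrt_mult mult.assoc)
    then show ?thesis by (simp add: mult.assoc[symmetric])
  qed
  have down: "sqrt (real (Suc k) * (real (Suc k) + \<alpha>)) * n k = (real (Suc k) + \<alpha>) * n (Suc k)" for k
  proof -
    have "sqrt (real (Suc k) * (real (Suc k) + \<alpha>)) * n k
        = sqrt (real (Suc k) + \<alpha>) * (sqrt (real (Suc k) + \<alpha>) * n (Suc k))"
      unfolding n_Suc[symmetric] by (simp only: real_sqrt_mult mult_ac)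
    then show ?thesis using assms by (simp add: mult.assoc[symmetric])
  qed
  show ?thesis
  proof (intro exI conjI)
    show "- sqrt (real N * (real N + \<alpha>)) * - sqrt (real N * (real N + \<alpha>)) = real N * (real N + \<alpha>)"
      using pos by simp
    show "classical_orthonormal N z (laguerre_onp \<alpha>) [:0, 1:] [:\<alpha> + 1, -1:]
            (n N * lead_coeff (laguerre_poly \<alpha> N)) real (\<lambda>k. - sqrt (real k * (real k + \<alpha>)))
            (\<lambda>k. 2 * real k + 1 + \<alpha>) (- sqrt (real N * (real N + \<alpha>)))"
    proof
      show "strict_mono_on {..<N} z" using assms(3) by (simp add: ordered_zeros_def)
      show "laguerre_onp \<alpha> N = Polynomial.smult (n N * lead_coeff (laguerre_poly \<alpha> N)) (\<Prod>l<N. [:- z l, 1:])"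
        by (subst n, subst ordered_zeros_factor[OF assms(3) degree_laguerre nz]) simp
      show "n N * lead_coeff (laguerre_poly \<alpha> N) \<noteq> 0" using n_pos[of N] nz by simp
      show "ode [:0, 1:] [:\<alpha> + 1, -1:] (real k) (laguerre_onp \<alpha> k)" for k
        unfolding n by (intro ode_smult ode_laguerre)
      show "degree (laguerre_onp \<alpha> k) \<le> k" for k
        unfolding n by (rule order.trans[OF degree_smult_le]) (simp add: degree_laguerre)
      show "0 < poly [:0, 1:] (z i)" if "i < N" for i
      proof -
        have "poly (laguerre_poly \<alpha> N) (z i) = 0" using assms(3) that by (auto simp: ordered_zeros_def)
        then show ?thesis using laguerre_pos[OF assms(2), of "z i" N] by force
      qed
      show "[:0, 1:] * laguerre_onp \<alpha> k
          = Polynomial.smult (- sqrt (real (Suc k) * (real (Suc k) + \<alpha>))) (laguerre_onp \<alpha> (Suc k))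
          + Polynomial.smult (2 * real k + 1 + \<alpha>) (laguerre_onp \<alpha> k)
          + Polynomial.smult (- sqrt (real k * (real k + \<alpha>))) (laguerre_onp \<alpha> (k - 1))" for k
      proof -
        have "- sqrt (real k * (real k + \<alpha>)) * n (k - 1) = n k * (if k = 0 then 0 else - (real k + \<alpha>))"
        proof (cases k)
          case (Suc m)
          then have "sqrt (real k * (real k + \<alpha>)) * n (k - 1) = (real k + \<alpha>) * n k"
            using down[of m] by simp
          then show ?thesis using Suc by (simp only: mult_minus_left) (simp add: algebra_simps)
        qed simp
        moreover have "- sqrt (real (Suc k) * (real (Suc k) + \<alpha>)) * n (Suc k) = n k * (- real (Suc k))"
          using up[of k] by (simp only: mult_minus_left mult_minus_right mult.commute)
        ultimately show ?thesis
          unfolding n mult_smult_right laguerre_three_term[of \<alpha> k]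
          by (simp only: smult_add_right smult_smult mult.commute)
      qed
      show "poly [:0, 1:] (z i) * poly (pderiv (laguerre_onp \<alpha> N)) (z i)
          = - sqrt (real N * (real N + \<alpha>)) * poly (laguerre_onp \<alpha> (N - 1)) (z i)" if "i < N" for i
      proof -
        have "poly (laguerre_poly \<alpha> N) (z i) = 0" using assms(3) that by (auto simp: ordered_zeros_def)
        moreover have "poly ([:0, 1:] * pderiv (laguerre_poly \<alpha> N)) (z i)
            = poly (Polynomial.smult (real N) (laguerre_poly \<alpha> N)
               - Polynomial.smult (real N + \<alpha>) (laguerre_poly \<alpha> (N - 1))) (z i)"
          using \<open>N > 0\<close> by (simp only: laguerre_structure) simp
        ultimately have "z i * poly (pderiv (laguerre_poly \<alpha> N)) (z i)
            = - ((real N + \<alpha>) * poly (laguerre_poly \<alpha> (N - 1)) (z i))"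
          by simp
        moreover have "sqrt (real N * (real N + \<alpha>)) * n (N - 1) = (real N + \<alpha>) * n N"
          using down[of "N - 1"] \<open>N > 0\<close> by simp
        ultimately show ?thesis
          by (simp add: n pderiv_smult mult.left_commute mult.assoc[symmetric]) (simp add: mult.commute)
      qed
      show "- sqrt (real N * (real N + \<alpha>)) * - sqrt (real N * (real N + \<alpha>)) > 0"
        using pos \<open>N > 0\<close> by simp
    qed auto
  qed
qed

lemma laguerre_spectral_data:
  assumes "N > 0" "\<nu> > 0" "ordered_zeros (laguerre_poly (\<nu> - 1) N) N z"
  defines "E \<equiv> Laguerre \<nu>"
  obtains A B C \<mu> a b c g where "classical_orthonormal N z (onp E) A B C \<mu> a b c"
    "a N * c = kappa E N"
    "\<And>x. poly A x = pi_fun E x"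
    "\<And>i j. i < N \<Longrightarrow> j < N \<Longrightarrow>
      s_entry E N z i j
        = g * (simple_zeros_ode.T N z A B i j * sqrt (pi_fun E (z j)) / sqrt (pi_fun E (z i)))"
    "\<And>k. k < N \<Longrightarrow> lam E N (N - k) = g * (\<mu> N - \<mu> k)"
    "\<And>k. k < N \<Longrightarrow> lam E N (N - k) \<noteq> 0"
proof -
  define \<alpha> where "\<alpha> = \<nu> - 1"
  have \<alpha>: "\<alpha> > - 1" using assms by (simp add: \<alpha>_def)
  define a where "a = (\<lambda>k. - sqrt (real k * (real k + \<alpha>)))"
  define b where "b = (\<lambda>k. 2 * real k + 1 + \<alpha>)"
  obtain C c where co: "classical_orthonormal N z (laguerre_onp \<alpha>) [:0, 1:] [:\<alpha> + 1, -1:] C real a b c"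
    and \<kappa>: "a N * c = real N * (real N + \<alpha>)"
    using classical_orthonormal_laguerre[OF assms(1) \<alpha> assms(3)[folded \<alpha>_def]]
    unfolding a_def b_def by blast
  interpret classical_orthonormal N z "laguerre_onp \<alpha>" "[:0, 1:]" "[:\<alpha> + 1, -1:]" C real a b c by fact
  have onp: "onp E = laguerre_onp \<alpha>" by (simp add: fun_eq_iff E_def \<alpha>_def)
  have pos: "z i > 0" if "i < N" for i using A_pos[OF that] by simp
  \<comment> \<open>This factorization links the entries of \<open>S\<close>, written in the square
    roots, with those of \<open>T\<close>, written in the zeros.\<close>
  have diff: "z i - z j = (sqrt (z i) - sqrt (z j)) * (sqrt (z i) + sqrt (z j))" if "i < N" "j < N" for i j
    using pos[OF that(1)] pos[OF that(2)] by (simp add: algebra_simps)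
  have ne: "sqrt (z i) - sqrt (z j) \<noteq> 0" if "i < N" "j < N" "i \<noteq> j" for i j
    using z_neq[OF that] by simp
  have ne': "sqrt (z i) + sqrt (z j) \<noteq> 0" if "i < N" "j < N" for i j
    using pos[OF that(1)] pos[OF that(2)] by (simp add: add_pos_pos less_imp_neq[THEN not_sym])
  have s: "s_entry E N z i j = 2 * (T i j * sqrt (z j) / sqrt (z i))" if ij: "i < N" "j < N" for i j
  proof (cases "i = j")
    case False
    have "1 / (x + y)\<^sup>2 - 1 / (x - y)\<^sup>2 = 2 * (- 2 * x\<^sup>2 / ((x - y) * (x + y))\<^sup>2 * y / x)"
      if "x + y \<noteq> 0" "x - y \<noteq> 0" "x \<noteq> 0" for x y :: real
    proof -
      have "1 / (x + y)\<^sup>2 - 1 / (x - y)\<^sup>2 = ((x - y)\<^sup>2 - (x + y)\<^sup>2) / ((x - y) * (x + y))\<^sup>2"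
        using that by (simp add: diff_divide_distrib power_mult_distrib)
      also have "(x - y)\<^sup>2 - (x + y)\<^sup>2 = - 4 * x * y"
        by (simp add: power2_eq_square algebra_simps)
      also have "\<dots> / ((x - y) * (x + y))\<^sup>2 = 2 * (- 2 * x\<^sup>2 / ((x - y) * (x + y))\<^sup>2 * y / x)"
        using that(3) by (simp add: power2_eq_square)
      finally show ?thesis .
    qed
    from this[of "sqrt (z i)" "sqrt (z j)"] show ?thesis
      using False ij z_neq[OF ij False] pos[OF ij(1)]
      by (simp add: E_def T_def Let_def diff ne ne' real_sqrt_pow2 del: power_mult_distrib)
  next
    case True
    \<comment> \<open>Over the common denominator the numerator is
      \<open>2 z i + 2 z l = 4 z i - 2 (z i - z l)\<close>, which separates the contributions to
      \<open>\<sigma>\<^sub>2\<close> and \<open>\<sigma>\<^sub>1\<close>.\<close>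
    have "1 / (sqrt (z i) + sqrt (z l))\<^sup>2 + 1 / (sqrt (z i) - sqrt (z l))\<^sup>2
        = 4 * z i * (1 / (z i - z l)\<^sup>2) - 2 * (1 / (z i - z l))" if "l \<in> {..<N} - {i}" for l
    proof -
      have l: "l < N" "i \<noteq> l" using that by auto
      have "1 / (x + y)\<^sup>2 + 1 / (x - y)\<^sup>2 = 4 * x\<^sup>2 * (1 / ((x - y) * (x + y))\<^sup>2) - 2 * (1 / ((x - y) * (x + y)))"
        if "x + y \<noteq> 0" "x - y \<noteq> 0" for x y :: real
      proof -
        have "1 / (x + y)\<^sup>2 + 1 / (x - y)\<^sup>2 = ((x - y)\<^sup>2 + (x + y)\<^sup>2) / ((x - y) * (x + y))\<^sup>2"
          using that by (simp add: add_divide_distrib power_mult_distrib)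
        also have "(x - y)\<^sup>2 + (x + y)\<^sup>2 = 4 * x\<^sup>2 - 2 * ((x - y) * (x + y))"
          by (simp add: power2_eq_square algebra_simps)
        also have "\<dots> / ((x - y) * (x + y))\<^sup>2
            = 4 * x\<^sup>2 * (1 / ((x - y) * (x + y))\<^sup>2) - 2 * (1 / ((x - y) * (x + y)))"
          using that by (simp add: diff_divide_distrib power2_eq_square)
        finally show ?thesis .
      qed
      from this[of "sqrt (z i)" "sqrt (z l)"] show ?thesis
        using ne[OF ij(1) l] ne'[OF ij(1) l(1)] pos[OF ij(1)]
        by (simp add: diff[OF ij(1) l(1)] del: power_mult_distrib)
    qed
    then have "(\<Sum>l\<in>{..<N} - {i}. 1 / (sqrt (z i) + sqrt (z l))\<^sup>2)
          + (\<Sum>l\<in>{..<N} - {i}. 1 / (sqrt (z i) - sqrt (z l))\<^sup>2) = 4 * z i * \<sigma>\<^sub>2 i - 2 * \<sigma>\<^sub>1 i"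
      unfolding \<sigma>\<^sub>1_def \<sigma>\<^sub>2_def sum_distrib_left sum.distrib[symmetric] sum_subtractf[symmetric]
      by (rule sum.cong[OF refl])
    \<comment> \<open>The Stieltjes relation for \<open>B = \<nu> - x\<close>: the leftover
      \<open>- 2 \<sigma>\<^sub>1\<close> cancels the \<open>1\<close> in the diagonal entry and
      doubles \<open>\<nu> / z i\<close>.\<close>
    moreover have "2 * \<sigma>\<^sub>1 i = 1 - \<nu> / z i"
      using stieltjes[OF ij(1)] pos[OF ij(1)] by (simp add: \<alpha>_def field_simps)
    ultimately have "s_entry E N z i i = 2 * (2 * z i * \<sigma>\<^sub>2 i) + 2 * \<nu> / z i"
      using pos[OF ij(1)] by (simp add: E_def Let_def)
    also have "\<dots> = 2 * T i i"
      unfolding T_def using pos[OF ij(1)] by (simp add: pderiv_pCons \<alpha>_def field_simps)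
    finally show ?thesis using True pos[OF ij(1)] by simp
  qed
  show ?thesis
  proof (rule that)
    show "classical_orthonormal N z (onp E) [:0, 1:] [:\<alpha> + 1, -1:] C real a b c"
      using co by (simp only: onp)
    show "a N * c = kappa E N" using \<kappa> by (simp add: E_def \<alpha>_def Let_def)
    show "poly [:0, 1:] x = pi_fun E x" for x by (simp add: E_def)
    show "s_entry E N z i j = 2 * (T i j * sqrt (pi_fun E (z j)) / sqrt (pi_fun E (z i)))"
      if "i < N" "j < N" for i j
      using s[OF that] by (simp add: E_def del: s_entry.simps)
    show "lam E N (N - k) = 2 * (real N - real k)" if "k < N" for k
      using that by (simp add: E_def of_nat_diff)
    show "lam E N (N - k) \<noteq> 0" if "k < N" for k
      using that by (simp add: E_def)
  qed
qed

section \<open>Orthonormal eigenfunctions\<close>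

text \<open>\<open>\<L>\<close> stands for the mean with respect to a weight \<open>w\<close> with
  \<open>(A w)' = B w\<close>; \<open>pearson\<close> then says that the derivative of
  \<open>A w q\<close> integrates to zero.\<close>

locale orthonormal_ode_family =
  fixes \<L> :: "real poly \<Rightarrow> real" and A B :: "real poly" and \<mu> :: "nat \<Rightarrow> real" and p :: "nat \<Rightarrow> real poly"
  assumes L_add: "\<L> (q + r) = \<L> q + \<L> r"
    and L_smult: "\<L> (Polynomial.smult c q) = c * \<L> q"
    and pearson: "\<L> (A * pderiv q + B * q) = 0"
    and ode_p: "ode A B (\<mu> k) (p k)"
    and inj_\<mu>: "inj \<mu>"
    and degree_p: "degree (p k) = k"
    and norm_p: "\<L> (p k * p k) = 1"
begin

lemma L_zero: "\<L> 0 = 0"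
  using L_smult[of 0 0] by simp

lemma L_diff: "\<L> (q - r) = \<L> q - \<L> r"
  using L_add[of q "Polynomial.smult (- 1) r"] L_smult[of "- 1" r] by simp

lemma L_sum: "\<L> (\<Sum>i\<in>I. f i) = (\<Sum>i\<in>I. \<L> (f i))"
  by (induction I rule: infinite_finite_induct) (simp_all add: L_zero L_add)

lemma by_parts: "\<L> (A * pderiv q * r) = - \<L> (q * (A * pderiv r + B * r))"
proof -
  have "A * pderiv (q * r) + B * (q * r) = A * pderiv q * r + q * (A * pderiv r + B * r)"
    by (simp add: pderiv_mult algebra_simps)
  then show ?thesis using pearson[of "q * r"] L_add by simp
qed

lemma eigen: "A * pderiv (pderiv (p k)) + B * pderiv (p k) = Polynomial.smult (- \<mu> k) (p k)"
  using ode_p[of k] by (simp add: ode_def eq_neg_iff_add_eq_0)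

text \<open>Integration by parts makes the differential operator symmetric, so eigenfunctions for
  distinct eigenvalues are orthogonal.\<close>

lemma orthogonal:
  assumes "j \<noteq> k"
  shows "\<L> (p j * p k) = 0"
proof -
  have sym: "\<mu> k * \<L> (p j * p k) = \<L> (A * pderiv (p j) * pderiv (p k))" for j k
    unfolding by_parts eigen by (simp only: mult_smult_right L_smult mult_minus_left minus_minus)
  have "\<mu> k * \<L> (p j * p k) = \<mu> j * \<L> (p j * p k)"
    using sym[of k j] sym[of j k] by (simp add: mult_ac)
  then show ?thesis using assms inj_\<mu> by (auto dest: injD)
qed

lemma p_nz: "p k \<noteq> 0"
  using norm_p[of k] L_zero by auto

lemma top_coeff_nz: "coeff (p k) k \<noteq> 0"
  using leading_coeff_neq_0[OF p_nz, of k] by (simp add: degree_p)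

lemma in_span: "degree q \<le> n \<Longrightarrow> \<exists>c. q = (\<Sum>k\<le>n. Polynomial.smult (c k) (p k))"
proof (induction n arbitrary: q)
  case 0
  obtain a where a: "q = [:a:]" using 0 degree_eq_zeroE by auto
  obtain b where b: "p 0 = [:b:]" using degree_p[of 0] degree_eq_zeroE by auto
  have "b \<noteq> 0" using b p_nz[of 0] by auto
  then show ?case by (intro exI[of _ "\<lambda>_. a / b"]) (simp add: a b)
next
  case (Suc n)
  define c' where "c' = coeff q (Suc n) / lead_coeff (p (Suc n))"
  have "degree (q - Polynomial.smult c' (p (Suc n))) \<le> n"
  proof (rule degree_le, intro allI impI)
    fix i assume "n < i"
    then show "coeff (q - Polynomial.smult c' (p (Suc n))) i = 0"
      using Suc.prems degree_p[of "Suc n"] top_coeff_nz[of "Suc n"]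
      by (cases "i = Suc n") (auto simp: c'_def coeff_eq_0)
  qed
  then obtain c where c: "q - Polynomial.smult c' (p (Suc n)) = (\<Sum>k\<le>n. Polynomial.smult (c k) (p k))"
    using Suc.IH by blast
  have "q = (\<Sum>k\<le>Suc n. Polynomial.smult ((c(Suc n := c')) k) (p k))"
    using c by (simp add: algebra_simps)
  then show ?case by blast
qed

lemma expansion:
  assumes "degree q \<le> n"
  shows "q = (\<Sum>k\<le>n. Polynomial.smult (\<L> (q * p k)) (p k))"
proof -
  obtain c where c: "q = (\<Sum>k\<le>n. Polynomial.smult (c k) (p k))" using in_span[OF assms] by auto
  have "\<L> (q * p k) = c k" if "k \<le> n" for k
  proof -
    have "\<L> (q * p k) = (\<Sum>j\<le>n. c j * \<L> (p j * p k))"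
      unfolding c sum_distrib_right L_sum by (simp add: L_smult)
    also have "\<dots> = (\<Sum>j\<le>n. if j = k then c k else 0)"
      by (intro sum.cong) (auto simp: orthogonal norm_p)
    finally show ?thesis using that by simp
  qed
  then show ?thesis using c by simp
qed

lemma orthogonal_lower:
  assumes "degree q < k"
  shows "\<L> (p k * q) = 0"
proof -
  have "\<L> (p k * q) = (\<Sum>j\<le>degree q. \<L> (q * p j) * \<L> (p k * p j))"
    by (subst (1) expansion[of q "degree q"]) (simp_all add: sum_distrib_left L_sum L_smult)
  also have "\<dots> = 0" using assms by (intro sum.neutral) (auto simp: orthogonal)
  finally show ?thesis .
qed

text \<open>\<open>three_term\<close> refers to \<open>p (k - 1)\<close>, which is
  \<open>p 0\<close> at \<open>k = 0\<close>; the value \<open>0\<close> removes that term.\<close>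

definition a :: "nat \<Rightarrow> real" where "a k = (if k = 0 then 0 else \<L> ([:0, 1:] * p (k - 1) * p k))"

definition b :: "nat \<Rightarrow> real" where "b k = \<L> ([:0, 1:] * p k * p k)"

lemma expansion_top_two:
  assumes "degree q \<le> Suc n" and low: "\<And>k. k < n \<Longrightarrow> \<L> (q * p k) = 0"
  shows "q = Polynomial.smult (\<L> (q * p (Suc n))) (p (Suc n)) + Polynomial.smult (\<L> (q * p n)) (p n)"
proof -
  have "q = (\<Sum>k\<in>{..Suc n}. Polynomial.smult (\<L> (q * p k)) (p k))"
    by (rule expansion[OF assms(1)])
  also have "\<dots> = (\<Sum>k\<in>{n, Suc n}. Polynomial.smult (\<L> (q * p k)) (p k))"
    using low by (intro sum.mono_neutral_right) (auto simp: not_le less_Suc_eq)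
  finally show ?thesis by (simp add: add.commute)
qed

text \<open>Moving \<open>x\<close> to the other factor shows that \<open>x * p k\<close> is
  orthogonal to \<open>p j\<close> for \<open>j + 1 < k\<close>; after subtracting the component
  along \<open>p (k - 1)\<close> two coefficients remain. Symmetry of
  \<open>\<L> (x * p j * p k)\<close> in \<open>j\<close> and \<open>k\<close> is why a single
  sequence \<open>a\<close> suffices.\<close>

lemma three_term:
  "[:0, 1:] * p k = Polynomial.smult (a (Suc k)) (p (Suc k)) + Polynomial.smult (b k) (p k)
     + Polynomial.smult (a k) (p (k - 1))"
proof (cases k)
  case 0
  have "degree ([:0, 1:] * p k) \<le> Suc k"
    using degree_mult_le[of "[:0, 1:]" "p k"] degree_p[of k] by simp
  then have "[:0, 1:] * p k = Polynomial.smult (\<L> ([:0, 1:] * p k * p (Suc k))) (p (Suc k))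
      + Polynomial.smult (\<L> ([:0, 1:] * p k * p k)) (p k)"
    by (rule expansion_top_two) (simp add: 0)
  moreover have "\<L> ([:0, 1:] * p k * p (Suc k)) = a (Suc k)" "\<L> ([:0, 1:] * p k * p k) = b k" "a k = 0"
    by (simp_all add: a_def b_def 0)
  ultimately show ?thesis by (simp only: smult_0_left add_0_right)
next
  case (Suc m)
  define q where "q = [:0, 1:] * p k - Polynomial.smult (a k) (p m)"
  have deg: "degree ([:0, 1:] * p j) \<le> Suc j" for j
    using degree_mult_le[of "[:0, 1:]" "p j"] degree_p[of j] by simp
  have lq: "\<L> (q * p j) = \<L> ([:0, 1:] * p k * p j) - a k * \<L> (p m * p j)" for j
    by (simp only: q_def left_diff_distrib L_diff mult_smult_left L_smult)
  have "q = Polynomial.smult (\<L> (q * p (Suc k))) (p (Suc k)) + Polynomial.smult (\<L> (q * p k)) (p k)"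
  proof (rule expansion_top_two)
    show "degree q \<le> Suc k"
      unfolding q_def using deg[of k] Suc
      by (intro degree_diff_le) (auto intro!: order.trans[OF degree_smult_le] simp: degree_p)
    fix j assume "j < k"
    show "\<L> (q * p j) = 0"
    proof (cases "j = m")
      case True
      then show ?thesis using Suc by (simp add: lq norm_p a_def mult_ac)
    next
      case False
      then have "degree ([:0, 1:] * p j) < k" using deg[of j] \<open>j < k\<close> Suc by linarith
      from orthogonal_lower[OF this] show ?thesis
        using False orthogonal[of m j] by (simp add: lq mult_ac)
    qed
  qed
  moreover have "\<L> (q * p (Suc k)) = a (Suc k)" "\<L> (q * p k) = b k"
    using Suc orthogonal[of m "Suc k"] orthogonal[of m k] by (simp_all add: lq a_def b_def)
  ultimately have "q = Polynomial.smult (a (Suc k)) (p (Suc k)) + Polynomial.smult (b k) (p k)"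
    by simp
  then show ?thesis using Suc by (simp add: q_def algebra_simps)
qed

lemma a_lead: "a (Suc k) = lead_coeff (p k) / lead_coeff (p (Suc k))"
proof -
  have "coeff ([:0, 1:] * p k) (Suc k) = a (Suc k) * coeff (p (Suc k)) (Suc k)"
    unfolding three_term using degree_p[of k] degree_p[of "k - 1"] by (simp add: coeff_eq_0)
  then show ?thesis
    using top_coeff_nz[of "Suc k"] by (simp add: degree_p field_simps)
qed

text \<open>Adding a multiple of \<open>x * p\<^sub>n\<close> cancels the leading term of \<open>A * p\<^sub>n'\<close> for quadratic \<open>A\<close>;
  integration by parts then leaves only the two top coefficients.\<close>

lemma derivative_relation:
  assumes "A = [:a\<^sub>0, a\<^sub>1, a\<^sub>2:]" "degree B \<le> 1"
  obtains c d where "A * pderiv (p (Suc n)) - Polynomial.smult (real (Suc n) * a\<^sub>2) ([:0, 1:] * p (Suc n))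
    = Polynomial.smult d (p (Suc n)) + Polynomial.smult c (p n)"
proof -
  define r where "r = real (Suc n) * a\<^sub>2"
  define q where "q = A * pderiv (p (Suc n)) - Polynomial.smult r ([:0, 1:] * p (Suc n))"
  have "q = Polynomial.smult (\<L> (q * p (Suc n))) (p (Suc n)) + Polynomial.smult (\<L> (q * p n)) (p n)"
  proof (rule expansion_top_two)
    have dA: "degree A \<le> 2" by (simp add: assms(1))
    show "degree q \<le> Suc n"
    proof (rule degree_le, intro allI impI)
      fix i assume "Suc n < i"
      then obtain m where m: "i = Suc (Suc m)" "n \<le> m" by (cases i; cases "i - 1") auto
      show "coeff q i = 0"
        using m degree_p[of "Suc n"] unfolding q_def assms(1) r_def
        by (cases "m = n") (auto simp: coeff_pderiv coeff_eq_0)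
    qed
    fix k assume "k < n"
    \<comment> \<open>Integration by parts moves the derivative onto \<open>p k\<close>. The
      resulting degree is at most \<open>k + 1 \<le> n\<close>, so orthogonality to
      \<open>p (Suc n)\<close> applies.\<close>
    have "degree (A * pderiv (p k) + B * p k + Polynomial.smult r ([:0, 1:] * p k)) \<le> Suc k"
    proof (intro degree_add_le)
      show "degree (A * pderiv (p k)) \<le> Suc k"
      \<comment> \<open>For constant \<open>p k\<close> the truncated \<open>0 - 1 = 0\<close> would
        leave the bound \<open>2\<close>, one too large; there the derivative itself is
        zero.\<close>
      proof (cases k)
        case 0
        then have "pderiv (p k) = 0" using degree_p[of k] by (simp add: pderiv_eq_0_iff)
        then show ?thesis by simp
      next
        case (Suc m)
        then show ?thesis
          using degree_mult_le[of A "pderiv (p k)"] dA degree_pderiv[of "p k"] degree_p[of k] by simp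
      qed
      show "degree (B * p k) \<le> Suc k"
        using degree_mult_le[of B "p k"] assms(2) degree_p[of k] by simp
      show "degree (Polynomial.smult r ([:0, 1:] * p k)) \<le> Suc k"
        using degree_mult_le[of "[:0, 1:]" "p k"] degree_p[of k]
        by (intro order.trans[OF degree_smult_le]) simp
    qed
    then have "\<L> (p (Suc n) * (A * pderiv (p k) + B * p k + Polynomial.smult r ([:0, 1:] * p k))) = 0"
      using \<open>k < n\<close> by (intro orthogonal_lower) (simp add: degree_p)
    moreover have "\<L> (p (Suc n) * (A * pderiv (p k) + B * p k + Polynomial.smult r ([:0, 1:] * p k)))
        = \<L> (p (Suc n) * (A * pderiv (p k) + B * p k)) + r * \<L> ([:0, 1:] * p (Suc n) * p k)"
      unfolding distrib_left[of _ "A * pderiv (p k) + B * p k"] L_add mult_smult_right L_smult by (simp only: mult_ac)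
    moreover have "\<L> (q * p k) = \<L> (A * pderiv (p (Suc n)) * p k) - r * \<L> ([:0, 1:] * p (Suc n) * p k)"
      by (simp only: q_def left_diff_distrib L_diff mult_smult_left L_smult)
    ultimately show "\<L> (q * p k) = 0" unfolding by_parts by simp
  qed
  then show ?thesis using that unfolding q_def r_def by blast
qed

end

section \<open>The Jacobi weight\<close>

lemma jacobi_weight_eq:
  "x \<in> {-1<..<1} \<Longrightarrow> jacobi_weight \<alpha> \<beta> x = (1 - x) powr \<alpha> * (1 + x) powr \<beta>"
  "x \<notin> {-1<..<1} \<Longrightarrow> jacobi_weight \<alpha> \<beta> x = 0"
  by (auto simp: jacobi_weight_def)

lemma jacobi_weight_nonneg: "jacobi_weight \<alpha> \<beta> x \<ge> 0"
  by (simp add: jacobi_weight_def)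

lemma jacobi_weight_measurable [measurable]: "jacobi_weight \<alpha> \<beta> \<in> borel_measurable borel"
  unfolding jacobi_weight_def by measurable

text \<open>The substitution \<open>t = (1 + x) / 2\<close> turns the weight into a Beta
  integrand.\<close>

lemma integrable_jacobi_weight:
  assumes "\<alpha> > - 1" "\<beta> > - 1"
  shows "integrable lborel (jacobi_weight \<alpha> \<beta>)"
proof -
  define f where "f t = indicator {0..1} t * (t powr \<beta> * (1 - t) powr \<alpha>)" for t :: real
  have "integrable lborel f"
    using integrable_Beta[of "\<beta> + 1" "\<alpha> + 1"] assms unfolding f_def set_integrable_def by simp
  then have "integrable lborel (\<lambda>x. 2 powr \<alpha> * 2 powr \<beta> * f (1 / 2 + 1 / 2 * x))"
    by (intro integrable_mult_right lborel_integrable_real_affine) auto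
  also have "(\<lambda>x. 2 powr \<alpha> * 2 powr \<beta> * f (1 / 2 + 1 / 2 * x)) = jacobi_weight \<alpha> \<beta>"
  proof
    fix x :: real
    \<comment> \<open>The closed and the open interval differ at the end points, where both
      functions are zero because \<open>0 powr c = 0\<close> for every \<open>c\<close>.\<close>
    consider "x \<in> {-1<..<1}" | "x = 1 \<or> x = -1" | "x < -1 \<or> x > 1" by force
    then show "2 powr \<alpha> * 2 powr \<beta> * f (1 / 2 + 1 / 2 * x) = jacobi_weight \<alpha> \<beta> x"
    proof cases
      case 1
      have "(1 + x) powr \<beta> = 2 powr \<beta> * (1 / 2 + 1 / 2 * x) powr \<beta>"
        using 1 by (subst powr_mult[symmetric]) (auto simp: algebra_simps)
      moreover have "(1 - x) powr \<alpha> = 2 powr \<alpha> * (1 - (1 / 2 + 1 / 2 * x)) powr \<alpha>"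
        using 1 by (subst powr_mult[symmetric]) (auto simp: algebra_simps)
      ultimately show ?thesis using 1 by (simp add: jacobi_weight_eq f_def)
    qed (auto simp: jacobi_weight_def f_def)
  qed
  finally show ?thesis .
qed

lemma integrable_jacobi_weight_poly:
  assumes "\<alpha> > - 1" "\<beta> > - 1"
  shows "integrable lborel (\<lambda>x. jacobi_weight \<alpha> \<beta> x * poly q x)"
proof -
  have "bounded (poly q ` {-1..1})"
    by (intro compact_imp_bounded compact_continuous_image continuous_intros) auto
  then obtain K where K: "\<forall>x\<in>{-1..1}. \<bar>poly q x\<bar> \<le> K"
    by (auto simp: bounded_iff)
  have meas: "poly q \<in> borel_measurable borel"
    by (intro borel_measurable_continuous_onI continuous_intros)
  show ?thesis
  proof (rule Bochner_Integration.integrable_bound)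
    show "integrable lborel (\<lambda>x. K * jacobi_weight \<alpha> \<beta> x)"
      by (intro integrable_mult_right integrable_jacobi_weight assms)
    show "(\<lambda>x. jacobi_weight \<alpha> \<beta> x * poly q x) \<in> borel_measurable lborel"
      using meas by measurable
    show "AE x in lborel. norm (jacobi_weight \<alpha> \<beta> x * poly q x) \<le> norm (K * jacobi_weight \<alpha> \<beta> x)"
    proof (intro AE_I2)
      fix x
      show "norm (jacobi_weight \<alpha> \<beta> x * poly q x) \<le> norm (K * jacobi_weight \<alpha> \<beta> x)"
      proof (cases "x \<in> {-1<..<1}")
        case True
        then have "\<bar>poly q x\<bar> \<le> \<bar>K\<bar>" using K[rule_format, of x] by auto
        then show ?thesis by (simp add: abs_mult mult.commute mult_right_mono)
      qed (simp add: jacobi_weight_eq)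
    qed
  qed
qed

definition jacobi_mean :: "real \<Rightarrow> real \<Rightarrow> real poly \<Rightarrow> real" where
  "jacobi_mean \<alpha> \<beta> q = (LINT x|lborel. jacobi_weight \<alpha> \<beta> x * poly q x) / (LINT y|lborel. jacobi_weight \<alpha> \<beta> y)"

lemma integral_jacobi_measure:
  "(LINT x|jacobi_measure \<alpha> \<beta>. poly q x) = jacobi_mean \<alpha> \<beta> q"
proof -
  have "poly q \<in> borel_measurable borel"
    by (intro borel_measurable_continuous_onI continuous_intros)
  then have "(LINT x|jacobi_measure \<alpha> \<beta>. poly q x)
      = (LINT x|lborel. (jacobi_weight \<alpha> \<beta> x / (LINT y|lborel. jacobi_weight \<alpha> \<beta> y)) *\<^sub>R poly q x)"
    unfolding jacobi_measure_def
    by (intro integral_density) (auto intro!: AE_I2 divide_nonneg_nonneg Bochner_Integration.integral_nonneg simp: jacobi_weight_nonneg)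
  then show ?thesis by (simp add: jacobi_mean_def)
qed

text \<open>A vanishing integral would force \<open>q = 0\<close> almost everywhere on an interval
  of positive measure, but \<open>q\<close> has finitely many roots.\<close>

lemma integral_jacobi_weight_pos:
  assumes "\<alpha> > - 1" "\<beta> > - 1" "q \<noteq> 0"
  shows "(LINT x|lborel. jacobi_weight \<alpha> \<beta> x * poly (q * q) x) > 0"
proof -
  have nonneg: "jacobi_weight \<alpha> \<beta> x * poly (q * q) x \<ge> 0" for x
    by (simp add: jacobi_weight_nonneg)
  have "(LINT x|lborel. jacobi_weight \<alpha> \<beta> x * poly (q * q) x) \<noteq> 0"
  proof
    assume "(LINT x|lborel. jacobi_weight \<alpha> \<beta> x * poly (q * q) x) = 0"
    then have "AE x in lborel. jacobi_weight \<alpha> \<beta> x * poly (q * q) x = 0"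
      using integral_nonneg_eq_0_iff_AE[OF integrable_jacobi_weight_poly[OF assms(1,2)] AE_I2[OF nonneg]]
      by blast
    moreover have "AE x in lborel. x \<notin> {x. poly q x = 0}"
      using poly_roots_finite[OF assms(3)] by (intro AE_not_in finite_imp_null_set_lborel)
    ultimately have "AE x in lborel. x \<notin> {-1<..<1::real}"
      by eventually_elim (auto simp: jacobi_weight_eq)
    then have "{-1<..<1::real} \<in> null_sets lborel"
      by (subst AE_iff_null_sets) auto
    then show False by (auto simp: null_sets_def)
  qed
  moreover have "(LINT x|lborel. jacobi_weight \<alpha> \<beta> x * poly (q * q) x) \<ge> 0"
    using nonneg by (intro Bochner_Integration.integral_nonneg)
  ultimately show ?thesis by simp
qed

lemma integral_jacobi_weight_pos':
  "\<alpha> > - 1 \<Longrightarrow> \<beta> > - 1 \<Longrightarrow> (LINT x|lborel. jacobi_weight \<alpha> \<beta> x) > 0"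
  using integral_jacobi_weight_pos[of \<alpha> \<beta> 1] by simp

lemma jacobi_mean_pos: "\<alpha> > - 1 \<Longrightarrow> \<beta> > - 1 \<Longrightarrow> q \<noteq> 0 \<Longrightarrow> jacobi_mean \<alpha> \<beta> (q * q) > 0"
  unfolding jacobi_mean_def by (intro divide_pos_pos integral_jacobi_weight_pos integral_jacobi_weight_pos')

lemma jacobi_mean_add:
  "\<alpha> > - 1 \<Longrightarrow> \<beta> > - 1 \<Longrightarrow> jacobi_mean \<alpha> \<beta> (q + r) = jacobi_mean \<alpha> \<beta> q + jacobi_mean \<alpha> \<beta> r"
  unfolding jacobi_mean_def
  by (simp add: distrib_left add_divide_distrib[symmetric] Bochner_Integration.integral_add integrable_jacobi_weight_poly)

lemma jacobi_mean_smult: "jacobi_mean \<alpha> \<beta> (Polynomial.smult c q) = c * jacobi_mean \<alpha> \<beta> q"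
  unfolding jacobi_mean_def by (simp add: mult.left_commute)

text \<open>The integrand is the derivative of \<open>(1 - x) powr (\<alpha> + 1) * (1 + x) powr (\<beta> + 1) * q x\<close>,
  which vanishes at the end points.\<close>

lemma jacobi_pearson:
  assumes "\<alpha> > - 1" "\<beta> > - 1"
  shows "jacobi_mean \<alpha> \<beta> ([:1, 0, -1:] * pderiv q + [:\<beta> - \<alpha>, - (\<alpha> + \<beta> + 2):] * q) = 0"
proof -
  define r where "r = [:1, 0, -1:] * pderiv q + [:\<beta> - \<alpha>, - (\<alpha> + \<beta> + 2):] * q"
  define F where "F x = (1 - x) powr (\<alpha> + 1) * (1 + x) powr (\<beta> + 1) * poly q x" for x
  have "((\<lambda>x. jacobi_weight \<alpha> \<beta> x * poly r x) has_integral (F 1 - F (-1))) {-1..1}"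
  \<comment> \<open>For negative exponents the derivative may be unbounded at the end points, while
    \<open>F\<close> is continuous there because \<open>\<alpha> + 1\<close> and
    \<open>\<beta> + 1\<close> are positive.\<close>
  proof (rule fundamental_theorem_of_calculus_interior)
    show "continuous_on {-1..1} F"
      unfolding F_def using assms by (intro continuous_intros continuous_on_powr') auto
    fix x :: real assume x: "x \<in> {-1<..<1}"
    have "(F has_real_derivative
        (- (\<alpha> + 1) * (1 - x) powr \<alpha> * (1 + x) powr (\<beta> + 1) * poly q x
         + (1 - x) powr (\<alpha> + 1) * ((\<beta> + 1) * (1 + x) powr \<beta>) * poly q x
         + (1 - x) powr (\<alpha> + 1) * (1 + x) powr (\<beta> + 1) * poly (pderiv q) x)) (at x)"
      unfolding F_def using x
      by (auto intro!: derivative_eq_intros poly_DERIV simp: algebra_simps powr_diff)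
    also have "(1 - x) powr (\<alpha> + 1) = (1 - x) powr \<alpha> * (1 - x)" using x by (simp add: powr_add)
    also have "(1 + x) powr (\<beta> + 1) = (1 + x) powr \<beta> * (1 + x)" using x by (simp add: powr_add)
    finally show "(F has_vector_derivative jacobi_weight \<alpha> \<beta> x * poly r x) (at x)"
      using x by (simp add: has_real_derivative_iff_has_vector_derivative jacobi_weight_eq r_def algebra_simps)
  qed simp
  then have "((\<lambda>x. jacobi_weight \<alpha> \<beta> x * poly r x) has_integral 0) {-1..1}"
    using assms by (simp add: F_def)
  then have "((\<lambda>x. jacobi_weight \<alpha> \<beta> x * poly r x) has_integral 0) UNIV"
    by (rule has_integral_on_superset) (auto simp: jacobi_weight_def)
  with has_integral_integral_lborel[OF integrable_jacobi_weight_poly[OF assms, of r]]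
  have "(LINT x|lborel. jacobi_weight \<alpha> \<beta> x * poly r x) = 0"
    by (rule has_integral_unique)
  then show ?thesis by (simp add: jacobi_mean_def r_def)
qed

section \<open>Jacobi polynomials\<close>

lemma gbinomial_step: "of_nat (Suc m) * (x gchoose Suc m) = (x - of_nat m) * (x gchoose m)" for x :: real
  using gbinomial_mult_1[of x m] by (simp add: algebra_simps)

definition jacobi_coeff :: "real \<Rightarrow> real \<Rightarrow> nat \<Rightarrow> nat \<Rightarrow> real" where
  "jacobi_coeff \<alpha> \<beta> k s = ((real k + \<alpha>) gchoose (k - s)) * ((real k + \<beta>) gchoose s)"

lemma jacobi_coeff_pos:
  "\<alpha> > - 1 \<Longrightarrow> \<beta> > - 1 \<Longrightarrow> s \<le> k \<Longrightarrow> jacobi_coeff \<alpha> \<beta> k s > 0"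
  unfolding jacobi_coeff_def by (intro mult_pos_pos gchoose_pos) (auto simp: of_nat_diff)

text \<open>A detailed-balance relation: what the monomial with exponent \<open>s\<close> sends to
  its neighbour \<open>Suc s\<close> under the operator equals what it receives from it. This makes
  the tridiagonal action diagonal on the full sum.\<close>

lemma jacobi_coeff_step:
  assumes "s < k"
  shows "jacobi_coeff \<alpha> \<beta> k (Suc s) * (real (Suc s) * (real (Suc s) + \<alpha>))
    = jacobi_coeff \<alpha> \<beta> k s * (real (k - s) * (real (k - s) + \<beta>))"
proof -
  have ks: "k - s = Suc (k - Suc s)" using assms by simp
  have "real (k - s) * ((real k + \<alpha>) gchoose (k - s)) = (real (Suc s) + \<alpha>) * ((real k + \<alpha>) gchoose (k - Suc s))"
    using gbinomial_step[of "k - Suc s" "real k + \<alpha>"] assms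
    by (simp only: ks[symmetric]) (simp add: of_nat_diff algebra_simps)
  moreover have "real (Suc s) * ((real k + \<beta>) gchoose Suc s) = (real (k - s) + \<beta>) * ((real k + \<beta>) gchoose s)"
    using gbinomial_step[of s "real k + \<beta>"] assms by (simp add: of_nat_diff algebra_simps)
  moreover have "(g1 * g2') * (s' * (s' + \<alpha>)) = (g2 * g1') * (d * (d + \<beta>))"
    if "d * g2 = (s' + \<alpha>) * g1" "s' * g2' = (d + \<beta>) * g1'" for g1 g2 g1' g2' d s' :: real
  proof -
    have "(g1 * g2') * (s' * (s' + \<alpha>)) = ((s' + \<alpha>) * g1) * (s' * g2')" by (simp only: mult_ac)
    also have "\<dots> = (g2 * g1') * (d * (d + \<beta>))" unfolding that(2) that(1)[symmetric] by (simp only: mult_ac)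
    finally show ?thesis .
  qed
  ultimately show ?thesis unfolding jacobi_coeff_def by blast
qed

lemma poly_jacobi:
  "poly (jacobi_poly \<alpha> \<beta> k) x
     = (\<Sum>s\<le>k. jacobi_coeff \<alpha> \<beta> k s * (((x - 1) / 2) ^ s * ((x + 1) / 2) ^ (k - s)))"
proof -
  have "poly [:-1/2, 1/2:] x = (x - 1) / 2" "poly [:1/2, 1/2:] x = (x + 1) / 2"
    by (simp_all add: field_simps)
  then show ?thesis
    by (simp only: jacobi_poly_def jacobi_coeff_def poly_sum poly_smult poly_mult poly_power)
qed

lemma jacobi_at_1: "poly (jacobi_poly \<alpha> \<beta> k) 1 = (real k + \<alpha>) gchoose k"
proof -
  have "poly (jacobi_poly \<alpha> \<beta> k) 1 = (\<Sum>s\<le>k. if s = 0 then jacobi_coeff \<alpha> \<beta> k 0 else 0)"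
    unfolding poly_jacobi by (intro sum.cong) (auto simp: power_0_left)
  then show ?thesis by (simp add: jacobi_coeff_def)
qed

lemma jacobi_at_minus_1: "poly (jacobi_poly \<alpha> \<beta> k) (-1) = (-1) ^ k * ((real k + \<beta>) gchoose k)"
proof -
  have "poly (jacobi_poly \<alpha> \<beta> k) (-1) = (\<Sum>s\<le>k. if s = k then jacobi_coeff \<alpha> \<beta> k k * (-1) ^ k else 0)"
    unfolding poly_jacobi by (intro sum.cong) (auto simp: power_0_left)
  then show ?thesis by (simp add: jacobi_coeff_def)
qed

text \<open>Outside the open interval \<open>(x - 1) / 2\<close> and \<open>(x + 1) / 2\<close> do
  not have opposite signs, so the terms of the expansion cannot cancel. The zeros therefore lie
  where \<open>1 - x^2\<close> is positive.\<close>

lemma jacobi_nonzero_outside: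
  assumes "\<alpha> > - 1" "\<beta> > - 1" "x \<le> - 1 \<or> x \<ge> 1"
  shows "poly (jacobi_poly \<alpha> \<beta> k) x \<noteq> 0"
proof -
  define U V where "U = (x - 1) / 2" and "V = (x + 1) / 2"
  have J: "poly (jacobi_poly \<alpha> \<beta> k) x = (\<Sum>s\<le>k. jacobi_coeff \<alpha> \<beta> k s * (U ^ s * V ^ (k - s)))"
    by (simp add: poly_jacobi U_def V_def)
  have c: "jacobi_coeff \<alpha> \<beta> k s > 0" if "s \<le> k" for s using jacobi_coeff_pos assms that by auto
  show ?thesis
  proof (cases "x \<ge> 1")
    case True
    then have "U \<ge> 0" "V > 0" by (auto simp: U_def V_def)
    then have "poly (jacobi_poly \<alpha> \<beta> k) x > 0"
      unfolding J using c by (intro sum_pos2[of _ 0]) (auto intro!: mult_nonneg_nonneg simp: less_imp_le)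
    then show ?thesis by simp
  next
    case False
    then have UV: "- U > 0" "- V \<ge> 0" using assms(3) by (auto simp: U_def V_def)
    have "U ^ s * V ^ (k - s) = (-1) ^ k * ((- U) ^ s * (- V) ^ (k - s))" if "s \<le> k" for s
    proof -
      have "(-1 :: real) ^ k = (-1) ^ s * (-1) ^ (k - s)" using that by (simp add: power_add[symmetric])
      then have "(-1) ^ k * ((- U) ^ s * (- V) ^ (k - s)) = ((-1) ^ s * (- U) ^ s) * ((-1) ^ (k - s) * (- V) ^ (k - s))"
        by (simp only: mult_ac)
      then show ?thesis by (simp only: power_mult_distrib[symmetric]) simp
    qed
    then have "poly (jacobi_poly \<alpha> \<beta> k) x
        = (-1) ^ k * (\<Sum>s\<le>k. jacobi_coeff \<alpha> \<beta> k s * ((- U) ^ s * (- V) ^ (k - s)))"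
      unfolding J sum_distrib_left by (intro sum.cong) auto
    moreover have "(\<Sum>s\<le>k. jacobi_coeff \<alpha> \<beta> k s * ((- U) ^ s * (- V) ^ (k - s))) > 0"
    \<comment> \<open>At \<open>x = -1\<close> the factor \<open>V\<close> vanishes and the term
      \<open>s = k\<close> is the one that survives.\<close>
    proof (rule sum_pos2[of _ k])
      show "0 < jacobi_coeff \<alpha> \<beta> k k * ((- U) ^ k * (- V) ^ (k - k))"
        using UV c[of k] by simp
      show "0 \<le> jacobi_coeff \<alpha> \<beta> k s * ((- U) ^ s * (- V) ^ (k - s))" if "s \<in> {..k}" for s
        using UV c[of s] that by (intro mult_nonneg_nonneg zero_le_power) auto
    qed auto
    ultimately show ?thesis by simp
  qed
qed

text \<open>The operator acts tridiagonally on \<open>((x - 1)/2) ^ s * ((x + 1)/2) ^ t\<close>, because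
  \<open>1 - x\<^sup>2 = - 4 u v\<close> and its first-order coefficient is linear homogeneous in
  \<open>u = (x - 1)/2\<close> and \<open>v = (x + 1)/2\<close>.\<close>

lemma jacobi_operator_monomial:
  fixes \<alpha> \<beta> x :: real
  defines "u \<equiv> [:-1/2, 1/2:] :: real poly" and "v \<equiv> [:1/2, 1/2:] :: real poly"
  defines "U \<equiv> (x - 1) / 2" and "V \<equiv> (x + 1) / 2"
  shows "poly ([:1, 0, -1:] * pderiv (pderiv (u ^ s * v ^ t)) + [:\<beta> - \<alpha>, - (\<alpha> + \<beta> + 2):] * pderiv (u ^ s * v ^ t)) x
    = - (real s * (real s + \<alpha>)) * (U ^ (s - 1) * V ^ Suc t)
      - (real t * (real t + \<beta>)) * (U ^ Suc s * V ^ (t - 1))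
      - (2 * real s * real t + (\<beta> + 1) * real s + (\<alpha> + 1) * real t) * (U ^ s * V ^ t)"
proof -
  have d: "pderiv u = [:1/2:]" "pderiv v = [:1/2:]" by (simp_all add: u_def v_def pderiv_pCons)
  have ev: "poly u x = U" "poly v x = V" by (simp_all add: u_def v_def U_def V_def diff_divide_distrib add_divide_distrib)
  have D: "pderiv (u ^ s * v ^ t)
      = Polynomial.smult (real s / 2) (u ^ (s - 1) * v ^ t) + Polynomial.smult (real t / 2) (u ^ s * v ^ (t - 1))" for s t
    unfolding pderiv_mult pderiv_power d by (simp add: mult_ac)
  have D1: "poly (pderiv (u ^ s * v ^ t)) x = (real s * (U ^ (s - 1) * V ^ t) + real t * (U ^ s * V ^ (t - 1))) / 2"
    unfolding D by (simp add: ev)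
  have D2: "poly (pderiv (pderiv (u ^ s * v ^ t))) x
      = (real s * real (s - 1) * (U ^ (s - 2) * V ^ t) + 2 * (real s * real t * (U ^ (s - 1) * V ^ (t - 1)))
          + real t * real (t - 1) * (U ^ s * V ^ (t - 2))) / 4"
    unfolding D pderiv_add pderiv_smult by (simp add: ev field_simps numeral_2_eq_2)
  have A: "1 - x\<^sup>2 = - 4 * U * V" by (simp add: U_def V_def power2_eq_square algebra_simps)
  have B: "\<beta> - \<alpha> - (\<alpha> + \<beta> + 2) * x = - 2 * ((\<beta> + 1) * U + (\<alpha> + 1) * V)"
    by (simp add: U_def V_def field_simps)
  have "poly ([:1, 0, -1:] * pderiv (pderiv (u ^ s * v ^ t)) + [:\<beta> - \<alpha>, - (\<alpha> + \<beta> + 2):] * pderiv (u ^ s * v ^ t)) x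
      = (1 - x\<^sup>2) * poly (pderiv (pderiv (u ^ s * v ^ t))) x
        + (\<beta> - \<alpha> - (\<alpha> + \<beta> + 2) * x) * poly (pderiv (u ^ s * v ^ t)) x"
    by (simp add: power2_eq_square algebra_simps)
  also have "\<dots> = - (real s * real (s - 1) * (U * U ^ (s - 2)) * V ^ Suc t
          + 2 * ((real s * (U * U ^ (s - 1))) * (real t * (V * V ^ (t - 1))))
          + real t * real (t - 1) * (V * V ^ (t - 2)) * U ^ Suc s)
      - ((\<beta> + 1) * (real s * (U * U ^ (s - 1))) * V ^ t + (\<beta> + 1) * real t * (U ^ Suc s * V ^ (t - 1))
          + (\<alpha> + 1) * real s * (U ^ (s - 1) * V ^ Suc t) + (\<alpha> + 1) * (real t * (V * V ^ (t - 1))) * U ^ s)"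
    unfolding D1 D2 A B by (simp add: field_simps)
  also have "real s * real (s - 1) * (U * U ^ (s - 2)) = real s * (real s - 1) * U ^ (s - 1)"
    by (cases s; cases "s - 1") (auto simp: numeral_2_eq_2)
  also have "real t * real (t - 1) * (V * V ^ (t - 2)) = real t * (real t - 1) * V ^ (t - 1)"
    by (cases t; cases "t - 1") (auto simp: numeral_2_eq_2)
  also have "real s * (U * U ^ (s - 1)) = real s * U ^ s" by (cases s) auto
  also have "real t * (V * V ^ (t - 1)) = real t * V ^ t" by (cases t) auto
  finally show ?thesis by (simp add: algebra_simps)
qed

text \<open>By \<open>jacobi_coeff_step\<close> the contributions of the neighbours to the monomial
  \<open>s\<close> are multiples of its own coefficient. With the diagonal one, the factors
  \<open>(k - s) (k - s + \<beta>)\<close> and \<open>s (s + \<alpha>)\<close> add up to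
  \<open>k (k + \<alpha> + \<beta> + 1)\<close>, independently of \<open>s\<close>.\<close>

lemma ode_jacobi:
  "ode [:1, 0, -1:] [:\<beta> - \<alpha>, - (\<alpha> + \<beta> + 2):] (real k * (real k + \<alpha> + \<beta> + 1)) (jacobi_poly \<alpha> \<beta> k)"
proof -
  define u v :: "real poly" where "u = [:-1/2, 1/2:]" and "v = [:1/2, 1/2:]"
  define M where "M q = [:1, 0, -1:] * pderiv (pderiv q) + [:\<beta> - \<alpha>, - (\<alpha> + \<beta> + 2):] * pderiv q" for q
  define c where "c = jacobi_coeff \<alpha> \<beta> k"
  have J: "jacobi_poly \<alpha> \<beta> k = (\<Sum>s\<le>k. Polynomial.smult (c s) (u ^ s * v ^ (k - s)))"
    by (simp add: jacobi_poly_def c_def jacobi_coeff_def u_def v_def)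
  have "poly (M (jacobi_poly \<alpha> \<beta> k)) x = - (real k * (real k + \<alpha> + \<beta> + 1)) * poly (jacobi_poly \<alpha> \<beta> k) x" for x
  proof -
    define U V where "U = (x - 1) / 2" and "V = (x + 1) / 2"
    have "M (jacobi_poly \<alpha> \<beta> k) = (\<Sum>s\<le>k. Polynomial.smult (c s) (M (u ^ s * v ^ (k - s))))"
      unfolding J M_def sum_pderiv pderiv_smult
      by (simp only: sum_distrib_left mult_smult_right sum.distrib smult_add_right)
    then have "poly (M (jacobi_poly \<alpha> \<beta> k)) x = (\<Sum>s\<le>k. c s * poly (M (u ^ s * v ^ (k - s))) x)"
      by (simp add: poly_sum)
    also have "\<dots> = - (\<Sum>s\<le>k. c s * (real s * (real s + \<alpha>)) * (U ^ (s - 1) * V ^ Suc (k - s)))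
        - (\<Sum>s\<le>k. c s * (real (k - s) * (real (k - s) + \<beta>)) * (U ^ Suc s * V ^ (k - s - 1)))
        - (\<Sum>s\<le>k. c s * (2 * real s * real (k - s) + (\<beta> + 1) * real s + (\<alpha> + 1) * real (k - s)) * (U ^ s * V ^ (k - s)))"
      unfolding M_def u_def v_def jacobi_operator_monomial U_def[symmetric] V_def[symmetric]
        sum_negf[symmetric] sum_subtractf[symmetric]
      by (intro sum.cong refl) (simp only: right_diff_distrib mult_minus_left mult_minus_right mult.assoc)
    also have "(\<Sum>s\<le>k. c s * (real s * (real s + \<alpha>)) * (U ^ (s - 1) * V ^ Suc (k - s)))
        = (\<Sum>s<k. c (Suc s) * (real (Suc s) * (real (Suc s) + \<alpha>)) * (U ^ s * V ^ Suc (k - Suc s)))"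
      by (subst lessThan_Suc_atMost[symmetric], subst sum.lessThan_Suc_shift) simp
    also have "\<dots> = (\<Sum>s<k. c s * (real (k - s) * (real (k - s) + \<beta>)) * (U ^ s * V ^ (k - s)))"
    proof (intro sum.cong refl)
      fix s assume "s \<in> {..<k}"
      then have s: "s < k" by simp
      show "c (Suc s) * (real (Suc s) * (real (Suc s) + \<alpha>)) * (U ^ s * V ^ Suc (k - Suc s))
          = c s * (real (k - s) * (real (k - s) + \<beta>)) * (U ^ s * V ^ (k - s))"
        unfolding c_def by (simp only: jacobi_coeff_step[OF s] Suc_diff_Suc[OF s])
    qed
    also have "\<dots> = (\<Sum>s\<le>k. c s * (real (k - s) * (real (k - s) + \<beta>)) * (U ^ s * V ^ (k - s)))"
      by (simp add: lessThan_Suc_atMost[symmetric])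
    also have "(\<Sum>s\<le>k. c s * (real (k - s) * (real (k - s) + \<beta>)) * (U ^ Suc s * V ^ (k - s - 1)))
        = (\<Sum>s<k. c s * (real (k - s) * (real (k - s) + \<beta>)) * (U ^ Suc s * V ^ (k - s - 1)))"
      by (simp add: lessThan_Suc_atMost[symmetric])
    also have "\<dots> = (\<Sum>s<k. c (Suc s) * (real (Suc s) * (real (Suc s) + \<alpha>)) * (U ^ Suc s * V ^ (k - Suc s)))"
    proof (intro sum.cong refl)
      fix s assume "s \<in> {..<k}"
      then have s: "s < k" "k - s - 1 = k - Suc s" by auto
      show "c s * (real (k - s) * (real (k - s) + \<beta>)) * (U ^ Suc s * V ^ (k - s - 1))
          = c (Suc s) * (real (Suc s) * (real (Suc s) + \<alpha>)) * (U ^ Suc s * V ^ (k - Suc s))"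
        unfolding c_def by (simp only: jacobi_coeff_step[OF s(1)] s(2))
    qed
    also have "\<dots> = (\<Sum>s\<le>k. c s * (real s * (real s + \<alpha>)) * (U ^ s * V ^ (k - s)))"
      by (subst lessThan_Suc_atMost[symmetric], subst sum.lessThan_Suc_shift) simp
    also have "- (\<Sum>s\<le>k. c s * (real (k - s) * (real (k - s) + \<beta>)) * (U ^ s * V ^ (k - s)))
        - (\<Sum>s\<le>k. c s * (real s * (real s + \<alpha>)) * (U ^ s * V ^ (k - s)))
        - (\<Sum>s\<le>k. c s * (2 * real s * real (k - s) + (\<beta> + 1) * real s + (\<alpha> + 1) * real (k - s)) * (U ^ s * V ^ (k - s)))
        = (\<Sum>s\<le>k. - (real k * (real k + \<alpha> + \<beta> + 1)) * (c s * (U ^ s * V ^ (k - s))))"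
      unfolding sum_negf[symmetric] sum_subtractf[symmetric]
    proof (intro sum.cong refl)
      fix s assume "s \<in> {..k}"
      then have *: "real (k - s) = real k - real s" by (simp add: of_nat_diff)
      show "- (c s * (real (k - s) * (real (k - s) + \<beta>)) * (U ^ s * V ^ (k - s)))
          - c s * (real s * (real s + \<alpha>)) * (U ^ s * V ^ (k - s))
          - c s * (2 * real s * real (k - s) + (\<beta> + 1) * real s + (\<alpha> + 1) * real (k - s)) * (U ^ s * V ^ (k - s))
          = - (real k * (real k + \<alpha> + \<beta> + 1)) * (c s * (U ^ s * V ^ (k - s)))"
        unfolding * by (simp add: algebra_simps)
    qed
    also have "\<dots> = - (real k * (real k + \<alpha> + \<beta> + 1)) * poly (jacobi_poly \<alpha> \<beta> k) x"
      unfolding poly_jacobi c_def U_def V_def sum_distrib_left ..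
    finally show ?thesis .
  qed
  then have "poly (M (jacobi_poly \<alpha> \<beta> k) + Polynomial.smult (real k * (real k + \<alpha> + \<beta> + 1)) (jacobi_poly \<alpha> \<beta> k)) x = 0" for x
    by (simp only: poly_add poly_smult) simp
  then have "M (jacobi_poly \<alpha> \<beta> k) + Polynomial.smult (real k * (real k + \<alpha> + \<beta> + 1)) (jacobi_poly \<alpha> \<beta> k) = 0"
    by (intro poly_all_0_iff_0[THEN iffD1]) blast
  then show ?thesis by (simp only: ode_def M_def)
qed

text \<open>Every \<open>u^s v^(k - s)\<close> has degree \<open>k\<close> and leading coefficient
  \<open>2^(-k)\<close>; Vandermonde's convolution sums the weights.\<close>

lemma coeff_jacobi_top:
  "coeff (jacobi_poly \<alpha> \<beta> k) k = (1 / 2) ^ k * ((2 * real k + \<alpha> + \<beta>) gchoose k)"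
  and degree_jacobi_le: "degree (jacobi_poly \<alpha> \<beta> k) \<le> k"
proof -
  define u v :: "real poly" where "u = [:-1/2, 1/2:]" and "v = [:1/2, 1/2:]"
  have nz: "u \<noteq> 0" "v \<noteq> 0" and deg: "degree u = 1" "degree v = 1" and lc: "lead_coeff u = 1 / 2" "lead_coeff v = 1 / 2"
    by (simp_all add: u_def v_def)
  have d: "degree (u ^ s * v ^ t) = s + t" for s t
    using nz deg by (simp add: degree_mult_eq degree_power_eq)
  have l: "coeff (u ^ s * v ^ t) (s + t) = (1 / 2) ^ (s + t)" for s t
    using lead_coeff_mult[of "u ^ s" "v ^ t"] lc unfolding d lead_coeff_power by (simp add: power_add)
  have J: "jacobi_poly \<alpha> \<beta> k = (\<Sum>s\<le>k. Polynomial.smult (jacobi_coeff \<alpha> \<beta> k s) (u ^ s * v ^ (k - s)))"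
    by (simp add: jacobi_poly_def jacobi_coeff_def u_def v_def)
  show "degree (jacobi_poly \<alpha> \<beta> k) \<le> k"
    unfolding J using d by (intro degree_sum_le) (auto intro!: order.trans[OF degree_smult_le])
  have "coeff (jacobi_poly \<alpha> \<beta> k) k = (\<Sum>s\<le>k. jacobi_coeff \<alpha> \<beta> k s * (1 / 2) ^ k)"
    unfolding J coeff_sum coeff_smult
  proof (intro sum.cong refl)
    fix s assume "s \<in> {..k}"
    then show "jacobi_coeff \<alpha> \<beta> k s * coeff (u ^ s * v ^ (k - s)) k = jacobi_coeff \<alpha> \<beta> k s * (1 / 2) ^ k"
      using l[of s "k - s"] by simp
  qed
  also have "\<dots> = (1 / 2) ^ k * (\<Sum>s=0..k. ((real k + \<beta>) gchoose s) * ((real k + \<alpha>) gchoose (k - s)))"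
    unfolding sum_distrib_left atMost_atLeast0 jacobi_coeff_def by (intro sum.cong refl) simp
  also have "(\<Sum>s=0..k. ((real k + \<beta>) gchoose s) * ((real k + \<alpha>) gchoose (k - s))) = (2 * real k + \<alpha> + \<beta>) gchoose k"
    unfolding gbinomial_Vandermonde by (simp add: algebra_simps)
  finally show "coeff (jacobi_poly \<alpha> \<beta> k) k = (1 / 2) ^ k * ((2 * real k + \<alpha> + \<beta>) gchoose k)" .
qed

lemma coeff_jacobi_top_pos:
  assumes "\<alpha> > - 1" "\<beta> > - 1"
  shows "coeff (jacobi_poly \<alpha> \<beta> k) k > 0"
proof (cases k)
  \<comment> \<open>\<open>gchoose_pos\<close> would require \<open>\<alpha> + \<beta> > - 1\<close>
    here, which may fail.\<close>
  case 0
  then show ?thesis by (simp add: jacobi_poly_def)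
next
  case (Suc m)
  then show ?thesis unfolding coeff_jacobi_top using assms by (intro mult_pos_pos gchoose_pos) auto
qed

lemma degree_jacobi:
  assumes "\<alpha> > - 1" "\<beta> > - 1"
  shows "degree (jacobi_poly \<alpha> \<beta> k) = k"
  using degree_jacobi_le[of \<alpha> \<beta> k] le_degree[of "jacobi_poly \<alpha> \<beta> k" k] coeff_jacobi_top_pos[OF assms, of k]
  by force

text \<open>Absorption twice takes \<open>m gchoose Suc k\<close> down to
  \<open>(m - 2) gchoose k\<close>, and \<open>m - 2 = 2 k + \<alpha> + \<beta>\<close>. It supplies
  the ratio of leading coefficients in \<open>a N\<close>.\<close>

lemma coeff_jacobi_top_ratio:
  fixes k :: nat
  assumes "real (Suc k) + \<alpha> + \<beta> \<noteq> 0"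
  defines "m \<equiv> 2 * real (Suc k) + \<alpha> + \<beta>"
  shows "coeff (jacobi_poly \<alpha> \<beta> (Suc k)) (Suc k) * (2 * real (Suc k) * (real (Suc k) + \<alpha> + \<beta>))
    = m * (m - 1) * coeff (jacobi_poly \<alpha> \<beta> k) k"
proof -
  define n where "n = real (Suc k)"
  have 1: "n * (m gchoose Suc k) = m * ((m - 1) gchoose k)"
    unfolding n_def by (rule gbinomial_absorption)
  have 2: "(n + \<alpha> + \<beta>) * ((m - 1) gchoose k) = (m - 1) * ((m - 2) gchoose k)"
    using gbinomial_absorb_comp[of "m - 1" k] by (simp add: m_def n_def algebra_simps)
  have "coeff (jacobi_poly \<alpha> \<beta> (Suc k)) (Suc k) * (2 * n * (n + \<alpha> + \<beta>))
      = (1 / 2) ^ k * ((n * (m gchoose Suc k)) * (n + \<alpha> + \<beta>))"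
    unfolding coeff_jacobi_top m_def[symmetric] by simp
  also have "\<dots> = (1 / 2) ^ k * (m * (m - 1) * ((m - 2) gchoose k))"
    unfolding 1 using 2 by (simp add: mult_ac)
  also have "\<dots> = m * (m - 1) * coeff (jacobi_poly \<alpha> \<beta> k) k"
    unfolding coeff_jacobi_top by (simp add: m_def algebra_simps)
  finally show ?thesis unfolding n_def .
qed

lemma jacobi_onp_eq:
  assumes "\<alpha> > - 1" "\<beta> > - 1"
  obtains n where "\<And>k. jacobi_onp \<alpha> \<beta> k = Polynomial.smult (n k) (jacobi_poly \<alpha> \<beta> k)" "\<And>k. n k > 0"
    "\<And>k. jacobi_mean \<alpha> \<beta> (jacobi_onp \<alpha> \<beta> k * jacobi_onp \<alpha> \<beta> k) = 1"
proof
  define h where "h k = jacobi_mean \<alpha> \<beta> (jacobi_poly \<alpha> \<beta> k * jacobi_poly \<alpha> \<beta> k)" for k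
  have "jacobi_poly \<alpha> \<beta> k \<noteq> 0" for k using coeff_jacobi_top_pos[OF assms, of k] by auto
  then have h: "h k > 0" for k unfolding h_def by (intro jacobi_mean_pos assms)
  have "(LINT x|jacobi_measure \<alpha> \<beta>. (poly (jacobi_poly \<alpha> \<beta> k) x)\<^sup>2) = h k" for k
    using integral_jacobi_measure[of \<alpha> \<beta> "jacobi_poly \<alpha> \<beta> k * jacobi_poly \<alpha> \<beta> k"]
    by (simp add: h_def power2_eq_square)
  then show eq: "jacobi_onp \<alpha> \<beta> k = Polynomial.smult (1 / sqrt (h k)) (jacobi_poly \<alpha> \<beta> k)" for k
    by (simp add: jacobi_onp_def)
  show "1 / sqrt (h k) > 0" for k using h by simp
  show "jacobi_mean \<alpha> \<beta> (jacobi_onp \<alpha> \<beta> k * jacobi_onp \<alpha> \<beta> k) = 1" for k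
    using h[of k] unfolding eq mult_smult_left mult_smult_right jacobi_mean_smult h_def[symmetric]
    by (simp add: field_simps)
qed

section \<open>The Jacobi family as an instance of the common setting\<close>

lemma classical_orthonormal_jacobi:
  fixes \<alpha> \<beta> :: real
  assumes "N \<ge> 2" "\<alpha> > - 1" "\<beta> > - 1" "ordered_zeros (jacobi_poly \<alpha> \<beta> N) N z"
  shows "\<exists>C a b c. classical_orthonormal N z (jacobi_onp \<alpha> \<beta>) [:1, 0, -1:] [:\<beta> - \<alpha>, - (\<alpha> + \<beta> + 2):] C
           (\<lambda>k. real k * (real k + \<alpha> + \<beta> + 1)) a b c
           \<and> a N * c = 4 * real N * (real N + \<alpha>) * (real N + \<beta>) * (real N + \<alpha> + \<beta>) /
               ((2 * real N + \<alpha> + \<beta>)\<^sup>2 * (2 * real N + \<alpha> + \<beta> - 1))"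
proof -
  define A where "A = [:1, 0, -1 :: real:]"
  define B where "B = [:\<beta> - \<alpha>, - (\<alpha> + \<beta> + 2):]"
  define \<mu> where "\<mu> k = real k * (real k + \<alpha> + \<beta> + 1)" for k
  define J where "J = jacobi_poly \<alpha> \<beta>"
  define p where "p = jacobi_onp \<alpha> \<beta>"
  obtain n where p: "\<And>k. p k = Polynomial.smult (n k) (J k)" and n_pos: "\<And>k. n k > 0"
    and norm: "\<And>k. jacobi_mean \<alpha> \<beta> (p k * p k) = 1"
    using jacobi_onp_eq[OF assms(2,3)] unfolding p_def J_def by metis
  have J: "degree (J k) = k" "coeff (J k) k > 0" "ode A B (\<mu> k) (J k)" for k
    unfolding J_def A_def B_def \<mu>_def
    using degree_jacobi[OF assms(2,3)] coeff_jacobi_top_pos[OF assms(2,3)] ode_jacobi by auto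
  \<comment> \<open>\<open>\<mu> j - \<mu> k\<close> factors as
    \<open>(j - k) (j + k + \<alpha> + \<beta> + 1)\<close>; for distinct indices
    \<open>j + k \<ge> 1\<close>, and \<open>\<alpha> + \<beta> > - 2\<close> makes the second
    factor positive.\<close>
  have inj: "inj \<mu>"
  proof (rule injI, rule ccontr)
    fix j k assume "\<mu> j = \<mu> k" "j \<noteq> k"
    then have "(real j - real k) * (real j + real k + \<alpha> + \<beta> + 1) = 0"
      by (simp add: \<mu>_def algebra_simps)
    moreover have "real j + real k \<ge> 1" using \<open>j \<noteq> k\<close> by linarith
    ultimately show False using \<open>j \<noteq> k\<close> assms(2,3) by auto
  qed
  interpret orth: orthonormal_ode_family "jacobi_mean \<alpha> \<beta>" A B \<mu> p
  proof
    show "jacobi_mean \<alpha> \<beta> (A * pderiv q + B * q) = 0" for q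
      unfolding A_def B_def by (rule jacobi_pearson[OF assms(2,3)])
    show "ode A B (\<mu> k) (p k)" for k unfolding p by (intro ode_smult J)
    show "degree (p k) = k" for k unfolding p using n_pos[of k] by (simp add: J)
  qed (use assms in \<open>simp_all add: jacobi_mean_add jacobi_mean_smult inj norm\<close>)
  obtain m where N: "N = Suc m" using assms(1) by (cases N) auto
  \<comment> \<open>The factor \<open>- 1\<close> is the quadratic coefficient of
    \<open>A = 1 - x^2\<close>.\<close>
  obtain c d where rel: "A * pderiv (p N) - Polynomial.smult (real N * - 1) ([:0, 1:] * p N)
      = Polynomial.smult d (p N) + Polynomial.smult c (p m)"
  proof -
    have "degree B \<le> 1" by (simp add: B_def)
    from orth.derivative_relation[OF A_def this, of m] show ?thesis using that N by auto
  qed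
  have ev: "(1 - x\<^sup>2) * poly (pderiv (p N)) x + real N * x * poly (p N) x = d * poly (p N) x + c * poly (p m) x" for x
    using arg_cong[OF rel, of "\<lambda>q. poly q x"] by (simp add: A_def power2_eq_square algebra_simps)
  \<comment> \<open>The last two bounds rest on \<open>N \<ge> 2\<close>, since
    \<open>\<alpha> + \<beta>\<close> is only known to exceed \<open>- 2\<close>.\<close>
  have pos: "real N + \<alpha> > 0" "real N + \<beta> > 0" "real N + \<alpha> + \<beta> > 0" "2 * real N + \<alpha> + \<beta> - 1 > 0"
    using assms(1-3) by (auto simp: N)
  \<comment> \<open>At \<open>x = 1\<close> and \<open>x = -1\<close> the derivative drops out,
    leaving two linear equations for \<open>c\<close> and \<open>d\<close>; weighting them with
    \<open>N + \<beta>\<close> and \<open>N + \<alpha>\<close> and adding eliminates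
    \<open>d\<close>.\<close>
  have c: "c * n m * (2 * real N + \<alpha> + \<beta>) = 2 * n N * (real N + \<alpha>) * (real N + \<beta>)"
  proof -
    define X Y where "X = ((real m + \<alpha>) gchoose m)" and "Y = ((real m + \<beta>) gchoose m)"
    have XY: "X > 0" "Y > 0" unfolding X_def Y_def using assms(2,3) by (auto intro!: gchoose_pos)
    have absorb: "real N * ((real N + \<gamma>) gchoose N) = (real N + \<gamma>) * ((real m + \<gamma>) gchoose m)" for \<gamma>
      using gbinomial_absorption[of m "real N + \<gamma>"] by (simp add: N)
    have v1: "real N * poly (p N) 1 = n N * ((real N + \<alpha>) * X)" "poly (p m) 1 = n m * X"
      unfolding p poly_smult J_def jacobi_at_1 X_def absorb[symmetric] by simp_all
    have v2: "real N * poly (p N) (-1) = - ((-1) ^ m * n N * ((real N + \<beta>) * Y))" "poly (p m) (-1) = (-1) ^ m * n m * Y"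
      unfolding p poly_smult J_def jacobi_at_minus_1 Y_def absorb[symmetric] by (simp_all add: N)
    have "(real N - d) * (real N * poly (p N) 1) = c * real N * poly (p m) 1"
      using arg_cong[OF ev[of 1], of "\<lambda>t. real N * t"] by (simp add: algebra_simps)
    then have "X * ((real N - d) * n N * (real N + \<alpha>)) = X * (c * real N * n m)"
      unfolding v1 by (simp add: mult_ac)
    then have 1: "(real N - d) * n N * (real N + \<alpha>) = c * real N * n m" using XY by simp
    have "- (real N + d) * (real N * poly (p N) (-1)) = c * real N * poly (p m) (-1)"
      using arg_cong[OF ev[of "-1"], of "\<lambda>t. real N * t"] by (simp add: algebra_simps)
    then have "((-1) ^ m * Y) * ((real N + d) * n N * (real N + \<beta>)) = ((-1) ^ m * Y) * (c * real N * n m)"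
      unfolding v2 by (simp only: mult_minus_left mult_minus_right minus_minus mult_ac)
    then have 2: "(real N + d) * n N * (real N + \<beta>) = c * real N * n m" using XY by simp
    have "real N * (c * n m * (2 * real N + \<alpha> + \<beta>))
        = (c * real N * n m) * (real N + \<beta>) + (c * real N * n m) * (real N + \<alpha>)"
      by (simp add: algebra_simps)
    also have "\<dots> = (real N - d) * n N * (real N + \<alpha>) * (real N + \<beta>) + (real N + d) * n N * (real N + \<beta>) * (real N + \<alpha>)"
      unfolding 1 2 ..
    also have "\<dots> = real N * (2 * n N * (real N + \<alpha>) * (real N + \<beta>))"
      by (simp add: algebra_simps)
    finally show ?thesis using assms(1) by simp
  qed
  have a_N: "orth.a N = (n m * coeff (J m) m) / (n N * coeff (J N) N)"
    unfolding N orth.a_lead p using n_pos by (simp add: J less_imp_neq[THEN not_sym])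
  have top: "coeff (J N) N * (2 * real N * (real N + \<alpha> + \<beta>))
      = (2 * real N + \<alpha> + \<beta>) * (2 * real N + \<alpha> + \<beta> - 1) * coeff (J m) m"
    using coeff_jacobi_top_ratio[of m \<alpha> \<beta>] pos by (simp add: N J_def)
  \<comment> \<open>The unevaluated norms enter \<open>a N\<close> as \<open>n m / n N\<close> and
    \<open>c\<close> as \<open>n N / n m\<close>, so they cancel in the product.\<close>
  have combine: "a * c = 4 * r * s * t * u / (v\<^sup>2 * w)"
    if "a = (n' * j') / (n * j)" "j * (2 * r * u) = v * w * j'" "c * n' * v = 2 * n * s * t"
      "v > 0" "w > 0" "n > 0" "j > 0" for a c r s t u v w n n' j j' :: real
  proof -
    have "a * c * (v\<^sup>2 * w) * (n * j) = (c * n' * v) * (v * w * j')"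
      using that by (simp add: power2_eq_square) (simp add: mult_ac)
    also have "\<dots> = (4 * r * s * t * u) * (n * j)"
      unfolding that(3) that(2)[symmetric] by (simp add: algebra_simps)
    finally have "a * c * (v\<^sup>2 * w) = 4 * r * s * t * u" using that(6,7) by simp
    then show ?thesis using that(4,5) by (simp add: eq_divide_eq)
  qed
  have \<kappa>: "orth.a N * c = 4 * real N * (real N + \<alpha>) * (real N + \<beta>) * (real N + \<alpha> + \<beta>) /
      ((2 * real N + \<alpha> + \<beta>)\<^sup>2 * (2 * real N + \<alpha> + \<beta> - 1))"
    using pos by (intro combine[OF a_N top c _ _ n_pos J(2)]) simp_all
  have zero: "poly (J N) (z i) = 0" if "i < N" for i
    using assms(4) that by (auto simp: ordered_zeros_def J_def)
  have "classical_orthonormal N z p A B (n N * lead_coeff (J N)) \<mu> orth.a orth.b c"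
  proof
    show "strict_mono_on {..<N} z" using assms(4) by (simp add: ordered_zeros_def)
    have "J N \<noteq> 0" using J(2)[of N] by auto
    then show "p N = Polynomial.smult (n N * lead_coeff (J N)) (\<Prod>l<N. [:- z l, 1:])"
      unfolding p
      by (subst ordered_zeros_factor[OF assms(4)[folded J_def] J(1)]) simp_all
    show "n N * lead_coeff (J N) \<noteq> 0" using n_pos[of N] J(2)[of N] by (simp add: J(1))
    show "0 < poly A (z i)" if "i < N" for i
    proof -
      have "z i > -1" "z i < 1"
        using jacobi_nonzero_outside[OF assms(2,3), of "z i" N] zero[OF that] unfolding J_def by force+
      then have "(1 - z i) * (1 + z i) > 0" by (intro mult_pos_pos) auto
      then show ?thesis by (simp add: A_def algebra_simps)
    qed
    show "poly A (z i) * poly (pderiv (p N)) (z i) = c * poly (p (N - 1)) (z i)" if "i < N" for i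
      using ev[of "z i"] zero[OF that] by (simp add: p A_def N power2_eq_square algebra_simps)
    show "orth.a 0 = 0" by (simp add: orth.a_def)
    show "0 < orth.a N * c"
      unfolding \<kappa> using pos assms(1) by (intro divide_pos_pos mult_pos_pos zero_less_power) auto
    show "[:0, 1:] * p k = Polynomial.smult (orth.a (Suc k)) (p (Suc k)) + Polynomial.smult (orth.b k) (p k)
        + Polynomial.smult (orth.a k) (p (k - 1))" for k
      by (rule orth.three_term)
  qed (use orth.ode_p orth.degree_p in auto)
  then show ?thesis using \<kappa> unfolding A_def B_def p_def \<mu>_def by blast
qed

lemma jacobi_spectral_data:
  assumes "N \<ge> 2" "a \<ge> 0" "b > 0" "ordered_zeros (jacobi_poly (a + b - 1) (b - 1) N) N z"
  defines "E \<equiv> Jacobi a b"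
  obtains A B C \<mu> a' b' c g where "classical_orthonormal N z (onp E) A B C \<mu> a' b' c"
    "a' N * c = kappa E N"
    "\<And>x. poly A x = pi_fun E x"
    "\<And>i j. i < N \<Longrightarrow> j < N \<Longrightarrow>
      s_entry E N z i j
        = g * (simple_zeros_ode.T N z A B i j * sqrt (pi_fun E (z j)) / sqrt (pi_fun E (z i)))"
    "\<And>k. k < N \<Longrightarrow> lam E N (N - k) = g * (\<mu> N - \<mu> k)"
    "\<And>k. k < N \<Longrightarrow> lam E N (N - k) \<noteq> 0"
proof -
  define \<alpha> \<beta> where "\<alpha> = a + b - 1" and "\<beta> = b - 1"
  have \<alpha>\<beta>: "\<alpha> > - 1" "\<beta> > - 1" using assms by (auto simp: \<alpha>_def \<beta>_def)
  define A where "A = [:1, 0, -1 :: real:]"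
  define B where "B = [:\<beta> - \<alpha>, - (\<alpha> + \<beta> + 2):]"
  define \<mu> where "\<mu> k = real k * (real k + \<alpha> + \<beta> + 1)" for k
  obtain C a' b' c where co: "classical_orthonormal N z (jacobi_onp \<alpha> \<beta>) A B C \<mu> a' b' c"
    and \<kappa>: "a' N * c = 4 * real N * (real N + \<alpha>) * (real N + \<beta>) * (real N + \<alpha> + \<beta>) /
               ((2 * real N + \<alpha> + \<beta>)\<^sup>2 * (2 * real N + \<alpha> + \<beta> - 1))"
    using classical_orthonormal_jacobi[OF assms(1) \<alpha>\<beta> assms(4)[folded \<alpha>_def \<beta>_def]]
    unfolding A_def B_def \<mu>_def by blast
  interpret classical_orthonormal N z "jacobi_onp \<alpha> \<beta>" A B C \<mu> a' b' c by fact
  have onp: "onp E = jacobi_onp \<alpha> \<beta>" by (simp add: fun_eq_iff E_def \<alpha>_def \<beta>_def)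
  have A: "poly A x = 1 - x\<^sup>2" for x by (simp add: A_def power2_eq_square)
  have s: "s_entry E N z i j = 2 * (T i j * sqrt (1 - (z j)\<^sup>2) / sqrt (1 - (z i)\<^sup>2))"
    if ij: "i < N" "j < N" for i j
  proof (cases "i = j")
    case False
    have "sqrt (1 - (z i)\<^sup>2) * sqrt (1 - (z i)\<^sup>2) = 1 - (z i)\<^sup>2" "sqrt (1 - (z i)\<^sup>2) \<noteq> 0"
      using A_pos[OF ij(1)] by (auto simp: A)
    moreover have "- 4 * (x * y) / d = 2 * (- 2 * w / d * x / y)" if "y * y = w" "y \<noteq> 0" for x y w d :: real
      using that(2) unfolding that(1)[symmetric] by simp
    ultimately show ?thesis
      using False unfolding T_def A E_def s_entry.simps real_sqrt_mult by (simp only: if_False)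
  next
    case True
    define x where "x = z i"
    have "(1 - x) * (1 + x) > 0" using A_pos[OF ij(1)] by (simp add: A x_def power2_eq_square algebra_simps)
    then have ne: "1 - x \<noteq> 0" "1 + x \<noteq> 0" by auto
    have q: "1 - x\<^sup>2 = (1 - x) * (1 + x)" by (simp add: power2_eq_square algebra_simps)
    have 1: "4 * (\<Sum>l\<in>{..<N} - {i}. (1 - x\<^sup>2) / (x - z l)\<^sup>2) = 4 * (1 - x\<^sup>2) * \<sigma>\<^sub>2 i"
      by (simp add: \<sigma>\<^sub>2_def x_def sum_distrib_left)
    have "2 * (a + b) * ((1 + x) / (1 - x)) + 2 * b * ((1 - x) / (1 + x))
        = (2 * (a + b) * (1 + x)\<^sup>2 + 2 * b * (1 - x)\<^sup>2) / (1 - x\<^sup>2)"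
    proof -
      have "r * (w / y) + s * (y / w) = (r * w\<^sup>2 + s * y\<^sup>2) / (y * w)" if "y \<noteq> 0" "w \<noteq> 0" for r s w y :: real
        using that by (simp add: add_divide_distrib power2_eq_square)
      from this[OF ne] show ?thesis unfolding q .
    qed
    \<comment> \<open>With \<open>a + b = \<alpha> + 1\<close> and \<open>b = \<beta> + 1\<close>
      the two boundary terms regroup into \<open>A' B / A\<close> and \<open>- B'\<close>, the
      rational part of the diagonal of \<open>T\<close>.\<close>
    also have "2 * (a + b) * (1 + x)\<^sup>2 + 2 * b * (1 - x)\<^sup>2
        = 2 * (- 2 * x * (\<beta> - \<alpha> - (\<alpha> + \<beta> + 2) * x)) + 2 * (\<alpha> + \<beta> + 2) * (1 - x\<^sup>2)"
      by (simp add: \<alpha>_def \<beta>_def power2_eq_square algebra_simps)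
    also have "\<dots> / (1 - x\<^sup>2) = 2 * (- 2 * x * (\<beta> - \<alpha> - (\<alpha> + \<beta> + 2) * x) / (1 - x\<^sup>2) + (\<alpha> + \<beta> + 2))"
    proof -
      have "(2 * r + 2 * s * w) / w = 2 * (r / w + s)" if "w \<noteq> 0" for r s w :: real
        using that by (simp add: add_divide_distrib)
      moreover have "1 - x\<^sup>2 \<noteq> 0" unfolding q using ne by simp
      ultimately show ?thesis by blast
    qed
    finally have 2: "2 * (a + b) * ((1 + x) / (1 - x)) + 2 * b * ((1 - x) / (1 + x)) = \<dots>" .
    have d: "poly (pderiv A) x = - 2 * x" "poly (pderiv B) x = - (\<alpha> + \<beta> + 2)"
      "poly B x = \<beta> - \<alpha> - (\<alpha> + \<beta> + 2) * x"
      by (simp_all add: A_def B_def pderiv_pCons algebra_simps)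
    have "T i i = 2 * (1 - x\<^sup>2) * \<sigma>\<^sub>2 i + - 2 * x * (\<beta> - \<alpha> - (\<alpha> + \<beta> + 2) * x) / (1 - x\<^sup>2) + (\<alpha> + \<beta> + 2)"
      unfolding T_def x_def[symmetric] d A by simp
    moreover have "4 * w * t + r + s = 2 * (2 * w * t + k + m)" if "r + s = 2 * (k + m)" for w t r s k m :: real
      using that by (simp add: algebra_simps)
    ultimately have "s_entry E N z i i = 2 * T i i"
      using 2 unfolding E_def s_entry.simps x_def[symmetric] by (simp only: 1 if_True refl)
    then show ?thesis using True ij A_pos[OF ij(1)] by (simp add: A)
  qed
  \<comment> \<open>Reversing the index turns the last factor of \<open>lam\<close> into
    \<open>N + k + \<alpha> + \<beta> + 1\<close>, the second factor of
    \<open>\<mu> N - \<mu> k\<close>.\<close>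
  have L: "lam E N (N - k) = 2 * (\<mu> N - \<mu> k)"
    and L_pos: "lam E N (N - k) > 0" if "k < N" for k
  proof -
    have E: "lam E N (N - k) = 2 * real (N - k) * (2 * real N + \<alpha> + \<beta> + 1 - real (N - k))"
      by (simp add: E_def \<alpha>_def \<beta>_def Let_def)
    have k: "real (N - k) = real N - real k" using that by (simp add: of_nat_diff)
    show "lam E N (N - k) = 2 * (\<mu> N - \<mu> k)"
      unfolding E k \<mu>_def by (simp add: algebra_simps)
    show "lam E N (N - k) > 0"
      unfolding E k using that \<alpha>\<beta> assms(1) by (intro mult_pos_pos) auto
  qed
  show ?thesis
  proof (rule that)
    show "classical_orthonormal N z (onp E) A B C \<mu> a' b' c" using co by (simp only: onp)
    show "a' N * c = kappa E N" using \<kappa> by (simp add: E_def \<alpha>_def \<beta>_def Let_def)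
    show "poly A x = pi_fun E x" for x by (simp add: E_def A)
    show "s_entry E N z i j = 2 * (T i j * sqrt (pi_fun E (z j)) / sqrt (pi_fun E (z i)))"
      if "i < N" "j < N" for i j
      using s[OF that] by (simp add: E_def del: s_entry.simps)
    show "lam E N (N - k) = 2 * (\<mu> N - \<mu> k)" if "k < N" for k by (rule L[OF that])
    show "lam E N (N - k) \<noteq> 0" if "k < N" for k using L_pos[OF that] by simp
  qed
qed

section \<open>Assembly of the three cases\<close>

theorem theorem4p8:
  fixes E :: ensemble and N :: nat and z :: "nat \<Rightarrow> real"
  assumes "N \<ge> 2"
    and "admissible E"
    and "ordered_zeros (classical_poly E N) N z"
  shows "invertible_mat (S_mat E N z) \<and>
    (\<forall>i<N. \<forall>j<N.
       Sigma_mat E N z $$ (i, j) =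
         sqrt (pi_fun E (z i) * pi_fun E (z j)) /
           (kappa E N * poly (onp E (N - 1)) (z i) * poly (onp E (N - 1)) (z j)) *
         (\<Sum>k = 0..N - 1. poly (onp E k) (z i) * poly (onp E k) (z j) / lam E N (N - k))
     \<and> Sigma_mat E N z $$ (i, j) =
         (-1) ^ (i + j) /
           sqrt (\<Sum>k = 0..N - 1. \<Sum>l = 0..N - 1.
                   (poly (onp E k) (z i))\<^sup>2 * (poly (onp E l) (z j))\<^sup>2) *
         (\<Sum>k = 0..N - 1. poly (onp E k) (z i) * poly (onp E k) (z j) / lam E N (N - k)))"
proof -
  have "N > 0" using assms(1) by simp
  obtain A B C \<mu> a b c g where *: "classical_orthonormal N z (onp E) A B C \<mu> a b c"
    "a N * c = kappa E N"
    "\<And>x. poly A x = pi_fun E x"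
    "\<And>i j. i < N \<Longrightarrow> j < N \<Longrightarrow>
      s_entry E N z i j = g * (simple_zeros_ode.T N z A B i j * sqrt (pi_fun E (z j)) / sqrt (pi_fun E (z i)))"
    "\<And>k. k < N \<Longrightarrow> lam E N (N - k) = g * (\<mu> N - \<mu> k)"
    "\<And>k. k < N \<Longrightarrow> lam E N (N - k) \<noteq> 0"
  proof (cases E)
    case Hermite
    then show ?thesis using hermite_spectral_data[of N z] assms \<open>N > 0\<close> that by auto
  next
    case (Laguerre \<nu>)
    then show ?thesis using laguerre_spectral_data[of N \<nu> z] assms \<open>N > 0\<close> that by auto
  next
    case (Jacobi a b)
    then show ?thesis using jacobi_spectral_data[of N a b z] assms that by auto
  qed
  show ?thesis by (rule covariance_from_classical[OF *(1) \<open>N > 0\<close> *(2-)])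
qed

end
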